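(* Let $\delta\ge 2$ and $\eta\ge 0$ be integers, let $0<\lambda\le 2^{-9\delta}\delta^{-1-\eta}$, let $\tau=\delta^{1+\eta}$, and let $\epsilon>0$. Let $G$ be an $\epsilon$-coherent graph with an equicardinal blockade $\mathcal{B}$ of length at least $6\delta^{\eta+2}$ and width at least $2^{9\delta}\epsilon|G|$, such that $\mathcal{B}$ is $\lambda$-concave, $\tau$-support-uniform and $(2^{-9\delta},\tau)$-support-invariant. Then $G$ contains $T(\delta,\eta)$.
   Context: All graphs are finite and simple; $|G|$ is the number of vertices; $G$ contains $H$ if some induced subgraph of $G$ is isomorphic to $H$. For $\epsilon>0$, $G$ is $\epsilon$-coherent if $|G|>1$, every vertex has degree less than $\epsilon|G|$, and there do not exist disjoint sets $A,B\subseteq V(G)$ with $|A|,|B|\ge\epsilon|G|$ and no edges between $A$ and $B$. Blockades: a blockade in $G$ is a sequence $\mathcal{B}=(B_i:i\in I)$ of pairwise disjoint nonempty subsets of $V(G)$ (blocks), $I$ a finite set of integers; its length is $|I|$, its width is $\min_i|B_i|$; it is equicardinal if all blocks have the same cardinality. A contraction of $\mathcal{B}$ is a blockade $(B_i':i\in I)$ with $\emptyset\ne B_i'\subseteq B_i$ for all $i$. $V(\mathcal{B})$ denotes the union of the blocks. An induced subgraph $H$ of $G$ is $\mathcal{B}$-rainbow if each vertex of $H$ lies in some block and no two lie in the same block; its support is the set of $i\in I$ with $V(H)\cap B_i\neq\emptyset$. The $\mathcal{B}$-ordering of a $\mathcal{B}$-rainbow $H$ is the linear order on $V(H)$ with $u<v$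 if $u\in B_i$, $v\in B_j$, $i<j$. An ordered graph is a graph with a linear order of its vertex set; a $\mathcal{B}$-rainbow $H$ is a copy of an ordered graph $J$ if $H$ with its $\mathcal{B}$-ordering is isomorphic to $J$ as ordered graphs. The trace of an ordered graph $J$ relative to $\mathcal{B}$ is the set of supports of all $\mathcal{B}$-rainbow copies of $J$. For an integer $\tau\ge1$, $\mathcal{B}$ is $\tau$-support-uniform if for every ordered tree $J$ with $|J|\le\tau$, the trace of $J$ relative to $\mathcal{B}$ is either empty or consists of all subsets of $I$ of cardinality $|J|$. For $0<\kappa\le1$, $\mathcal{B}$ is $(\kappa,\tau)$-support-invariant if for every contraction $\mathcal{B}'$ of $\mathcal{B}$ of width at least $\kappa$ times the width of $\mathcal{B}$, and every ordered tree $J$ with $|J|\le\tau$, the trace of $J$ relative to $\mathcal{B}$ equals the trace of $J$ relative to $\mathcal{B}'$. Concavity: let $\mathcal{B}=(B_i:i\in I)$ be equicardinal of width $w$ and $0\le\lambda\le 1/2$. A set $X\subseteq V(G)\setminus B_i$ $\lambda$-covers $B_i$ if at least $\lambda w$ vertices of $B_i$ have a neighbour in $X$, and $\lambda$-misses $B_i$ if at least $\lambda w$ vertices of $B_i$ have no neighbour in $X$. $\mathcal{B}$ is $\lambda$-concave if there do not exist $h_1<h_2<h_3$ in $I$ and $X\subseteq V(\mathcal{B})\setminus(B_{h_1}\cup B_{h_2}\cup B_{h_3})$ such that $X$ $\lambda$-covers $B_{h_2}$ and $\lambda$-misses both $B_{h_1}$ and $B_{h_3}$. Trees: for integer $\delta\ge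 2$, $T(\delta,0)$ is the one-vertex tree; for $\eta\ge1$, $T(\delta,\eta)$ is the rooted tree obtained from the disjoint union of $\delta$ copies of $T(\delta,\eta-1)$ by adding a new vertex adjacent to their roots and making it the root (equivalently: the root has degree $\delta$, every other vertex has degree $\delta+1$ or $1$, and every leaf is at distance exactly $\eta$ from the root). *)

theory Defs
  imports Complex_Main
begin

definition graph :: "'a set \<Rightarrow> ('a \<Rightarrow> 'a \<Rightarrow> bool) \<Rightarrow> bool" where
  "graph V E \<longleftrightarrow> finite V \<and> (\<forall>u\<in>V. \<forall>v\<in>V. E u v \<longleftrightarrow> E v u) \<and> (\<forall>v\<in>V. \<not> E v v)"

definition degree :: "'a set \<Rightarrow> ('a \<Rightarrow> 'a \<Rightarrow> bool) \<Rightarrow> 'a \<Rightarrow> nat" where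
  "degree V E v = card {u\<in>V. E v u}"

definition contains :: "'a set \<Rightarrow> ('a \<Rightarrow> 'a \<Rightarrow> bool) \<Rightarrow> 'b set \<Rightarrow> ('b \<Rightarrow> 'b \<Rightarrow> bool) \<Rightarrow> bool" where
  "contains V E W F \<longleftrightarrow> (\<exists>f. inj_on f W \<and> f ` W \<subseteq> V \<and>
      (\<forall>x\<in>W. \<forall>y\<in>W. F x y \<longleftrightarrow> E (f x) (f y)))"

definition coherent :: "real \<Rightarrow> 'a set \<Rightarrow> ('a \<Rightarrow> 'a \<Rightarrow> bool) \<Rightarrow> bool" where
  "coherent \<epsilon> V E \<longleftrightarrow> card V > 1 \<and>
     (\<forall>v\<in>V. real (degree V E v) < \<epsilon> * real (card V)) \<and>
     \<not> (\<exists>A B. A \<subseteq> V \<and> B \<subseteq> V \<and> A \<inter> B = {} \<and>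
            real (card A) \<ge> \<epsilon> * real (card V) \<and> real (card B) \<ge> \<epsilon> * real (card V) \<and>
            (\<forall>a\<in>A. \<forall>b\<in>B. \<not> E a b))"

text \<open>Vertices are the words over {0..<delta} of length at most eta (the root is the
  empty word); a word is adjacent to its one-letter extensions.\<close>
definition T_verts :: "nat \<Rightarrow> nat \<Rightarrow> nat list set" where
  "T_verts \<delta> \<eta> = {xs. length xs \<le> \<eta> \<and> set xs \<subseteq> {0..<\<delta>}}"

definition T_adj :: "nat list \<Rightarrow> nat list \<Rightarrow> bool" where
  "T_adj xs ys \<longleftrightarrow> (\<exists>i. ys = xs @ [i]) \<or> (\<exists>i. xs = ys @ [i])"

definition blockade :: "'a set \<Rightarrow> int set \<Rightarrow> (int \<Rightarrow> 'a set) \<Rightarrow> bool" where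
  "blockade V I B \<longleftrightarrow> finite I \<and> (\<forall>i\<in>I. B i \<noteq> {} \<and> B i \<subseteq> V) \<and>
     (\<forall>i\<in>I. \<forall>j\<in>I. i \<noteq> j \<longrightarrow> B i \<inter> B j = {})"

definition blen :: "int set \<Rightarrow> nat" where
  "blen I = card I"

definition bwidth :: "int set \<Rightarrow> (int \<Rightarrow> 'a set) \<Rightarrow> nat" where
  "bwidth I B = Min ((\<lambda>i. card (B i)) ` I)"

definition equicardinal :: "int set \<Rightarrow> (int \<Rightarrow> 'a set) \<Rightarrow> bool" where
  "equicardinal I B \<longleftrightarrow> (\<forall>i\<in>I. \<forall>j\<in>I. card (B i) = card (B j))"

definition contraction :: "int set \<Rightarrow> (int \<Rightarrow> 'a set) \<Rightarrow> (int \<Rightarrow> 'a set) \<Rightarrow> bool" where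
  "contraction I B B' \<longleftrightarrow> (\<forall>i\<in>I. B' i \<noteq> {} \<and> B' i \<subseteq> B i)"

definition bverts :: "int set \<Rightarrow> (int \<Rightarrow> 'a set) \<Rightarrow> 'a set" where
  "bverts I B = (\<Union>i\<in>I. B i)"

text \<open>Every ordered graph is isomorphic (as ordered graph) to one with vertex set
  {0..<n} ordered naturally; so ordered graphs on n vertices are represented by
  an adjacency relation J on {0..<n}.\<close>

definition ordered_tree :: "nat \<Rightarrow> (nat \<Rightarrow> nat \<Rightarrow> bool) \<Rightarrow> bool" where
  "ordered_tree n J \<longleftrightarrow> n \<ge> 1 \<and>
     (\<forall>u<n. \<forall>v<n. J u v \<longleftrightarrow> J v u) \<and> (\<forall>v<n. \<not> J v v) \<and>
     (\<forall>u<n. \<forall>v<n. (\<lambda>x y. x < n \<and> y < n \<and> J x y)\<^sup>*\<^sup>* u v) \<and>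
     card {(u, v). u < v \<and> v < n \<and> J u v} = n - 1"

text \<open>The trace of J relative to the blockade: supports of all rainbow copies of J.
  A rainbow copy is given by a map f of {0..<n} into V(B) and strictly increasing
  block indices g, with f k in B (g k); its vertex set is f ` {0..<n}, its
  B-ordering is that of the indices, and it is a copy iff f preserves adjacency
  and non-adjacency.\<close>
definition trace :: "('a \<Rightarrow> 'a \<Rightarrow> bool) \<Rightarrow> int set \<Rightarrow> (int \<Rightarrow> 'a set) \<Rightarrow> nat \<Rightarrow> (nat \<Rightarrow> nat \<Rightarrow> bool) \<Rightarrow> int set set" where
  "trace E I B n J = {g ` {0..<n} | g. \<exists>f.
      strict_mono_on {0..<n} g \<and> g ` {0..<n} \<subseteq> I \<and>
      (\<forall>k<n. f k \<in> B (g k)) \<and>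
      (\<forall>k<n. \<forall>l<n. k \<noteq> l \<longrightarrow> (J k l \<longleftrightarrow> E (f k) (f l)))}"

definition support_uniform :: "('a \<Rightarrow> 'a \<Rightarrow> bool) \<Rightarrow> nat \<Rightarrow> int set \<Rightarrow> (int \<Rightarrow> 'a set) \<Rightarrow> bool" where
  "support_uniform E \<tau> I B \<longleftrightarrow> (\<forall>n J. n \<le> \<tau> \<longrightarrow> ordered_tree n J \<longrightarrow>
      trace E I B n J = {} \<or> trace E I B n J = {S. S \<subseteq> I \<and> card S = n})"

definition support_invariant :: "('a \<Rightarrow> 'a \<Rightarrow> bool) \<Rightarrow> real \<Rightarrow> nat \<Rightarrow> int set \<Rightarrow> (int \<Rightarrow> 'a set) \<Rightarrow> bool" where
  "support_invariant E \<kappa> \<tau> I B \<longleftrightarrow> (\<forall>B'. contraction I B B' \<longrightarrow>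
      real (bwidth I B') \<ge> \<kappa> * real (bwidth I B) \<longrightarrow>
      (\<forall>n J. n \<le> \<tau> \<longrightarrow> ordered_tree n J \<longrightarrow> trace E I B n J = trace E I B' n J))"

definition covers :: "('a \<Rightarrow> 'a \<Rightarrow> bool) \<Rightarrow> real \<Rightarrow> nat \<Rightarrow> 'a set \<Rightarrow> 'a set \<Rightarrow> bool" where
  "covers E lam w X Bi \<longleftrightarrow> real (card {v\<in>Bi. \<exists>x\<in>X. E v x}) \<ge> lam * real w"

definition misses :: "('a \<Rightarrow> 'a \<Rightarrow> bool) \<Rightarrow> real \<Rightarrow> nat \<Rightarrow> 'a set \<Rightarrow> 'a set \<Rightarrow> bool" where
  "misses E lam w X Bi \<longleftrightarrow> real (card {v\<in>Bi. \<not> (\<exists>x\<in>X. E v x)}) \<ge> lam * real w"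

definition concave :: "('a \<Rightarrow> 'a \<Rightarrow> bool) \<Rightarrow> real \<Rightarrow> int set \<Rightarrow> (int \<Rightarrow> 'a set) \<Rightarrow> bool" where
  "concave E lam I B \<longleftrightarrow> \<not> (\<exists>h1\<in>I. \<exists>h2\<in>I. \<exists>h3\<in>I. \<exists>X. h1 < h2 \<and> h2 < h3 \<and>
      X \<subseteq> bverts I B - (B h1 \<union> B h2 \<union> B h3) \<and>
      covers E lam (bwidth I B) X (B h2) \<and>
      misses E lam (bwidth I B) X (B h1) \<and> misses E lam (bwidth I B) X (B h3))"

end

theory Submission
  imports Defs
begin

text \<open>Call a rooted tree left (right) realised if it has an ordering with the root first (last) whose
  trace is full. The key is a trichotomy: any two left realised trees can be merged by an edge
  between their roots, keeping the root of the first, or the same holds for any two right realised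
  trees, or for any left realised with any right realised tree (keeping either root). Each
  alternative yields a realised \<open>T(\<delta>, \<eta>)\<close> by hanging \<open>\<delta>\<close> copies of \<open>T(\<delta>, \<eta> - 1)\<close> on a new
  root one by one.

  For the trichotomy take blocks \<open>L\<^sub>1 < L\<^sub>2 < \<dots> < R\<^sub>2 < R\<^sub>1\<close> and copies with roots in \<open>L\<^sub>2\<close> or \<open>R\<^sub>2\<close> and
  all other vertices in the middle. By concavity a subset of \<open>L\<^sub>1 \<union> R\<^sub>1\<close> covers
  \<open>L\<^sub>2\<close> or \<open>R\<^sub>2\<close> well before it covers a middle block, so there are copies whose root has many more
  neighbours in \<open>L\<^sub>1 \<union> R\<^sub>1\<close> than their other vertices have. Collect such copies until half of \<open>L\<^sub>1\<close> or
  of \<open>R\<^sub>1\<close> is covered: many vertices there see just the root of some copy, while by concavity the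
  copies cover almost nothing of the middle blocks, so a second tree can be rooted at such a vertex
  without further edges to the copy.\<close>

section \<open>Induced copies of rooted trees\<close>

datatype rtree = Node (children: "rtree list")

fun tsize :: "rtree \<Rightarrow> nat" where
  "tsize (Node ts) = Suc (sum_list (map tsize ts))"

definition attach :: "rtree \<Rightarrow> rtree \<Rightarrow> rtree" where
  "attach t s = Node (s # children t)"

text \<open>The children are hung on one at a time, and each step creates a single edge between
  \<open>X\<close> and \<open>Z\<close>, the one joining the roots. Only edges directed from
  \<open>X\<close> to \<open>Z\<close> are restricted and loops are not mentioned, so this means an
  induced copy once \<open>R\<close> is symmetric and irreflexive on \<open>X\<close>.\<close>

inductive emb :: "('v \<Rightarrow> 'v \<Rightarrow> bool) \<Rightarrow> rtree \<Rightarrow> 'v \<Rightarrow> 'v set \<Rightarrow> bool" for R where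
  emb_single: "emb R (Node []) y {y}"
| emb_attach: "emb R (Node ts) y X \<Longrightarrow> emb R t z Z \<Longrightarrow> X \<inter> Z = {} \<Longrightarrow> R y z \<Longrightarrow>
    (\<And>u v. u \<in> X \<Longrightarrow> v \<in> Z \<Longrightarrow> R u v \<Longrightarrow> u = y \<and> v = z) \<Longrightarrow>
    emb R (Node (t # ts)) y (X \<union> Z)"

lemma emb_finite: "emb R t y X \<Longrightarrow> finite X"
proof (induction rule: emb.induct)
  case (emb_attach ts y X t z Z)
  show ?case using emb_attach.IH by (rule finite_UnI)
qed simp

lemma emb_root: "emb R t y X \<Longrightarrow> y \<in> X"
  by (induction rule: emb.induct) blast+

lemma emb_card: "emb R t y X \<Longrightarrow> card X = tsize t"
proof (induction rule: emb.induct)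
  case (emb_attach ts y X t z Z)
  have "card (X \<union> Z) = card X + card Z"
    using emb_finite[OF emb_attach.hyps(1)] emb_finite[OF emb_attach.hyps(2)] emb_attach.hyps(3) by (rule card_Un_disjoint)
  then show ?case by (simp add: emb_attach.IH)
qed simp

text \<open>Moves copies between an index set and \<open>{0..<n}\<close>. With \<open>f = id\<close>
  it replaces \<open>R\<close> by a relation that agrees with it on \<open>X\<close>.\<close>

lemma emb_map:
  assumes "emb R t y X" "inj_on f X"
    and "\<And>u v. u \<in> X \<Longrightarrow> v \<in> X \<Longrightarrow> R' (f u) (f v) \<longleftrightarrow> R u v"
  shows "emb R' t (f y) (f ` X)"
  using assms
proof (induction rule: emb.induct)
  case (emb_single y)
  show ?case by (simp add: emb.emb_single)
next
  case (emb_attach ts y X t z Z)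
  note inj = \<open>inj_on f (X \<union> Z)\<close> and R' = emb_attach.prems(2)
  have "emb R' (Node ts) (f y) (f ` X)"
    by (rule emb_attach.IH(1)) (use inj R' in \<open>auto simp: inj_on_Un\<close>)
  moreover have "emb R' t (f z) (f ` Z)"
    by (rule emb_attach.IH(2)) (use inj R' in \<open>auto simp: inj_on_Un\<close>)
  moreover have "f ` X \<inter> f ` Z = {}"
    using inj emb_attach.hyps(3) by (metis image_empty inj_on_image_Int le_sup_iff order_refl)
  moreover have "R' (f y) (f z)"
    using R' emb_attach.hyps emb_root by (metis UnCI)
  moreover have "a = f y \<and> b = f z" if ab: "a \<in> f ` X" "b \<in> f ` Z" "R' a b" for a b
    using ab emb_attach.hyps(5) R' by auto
  ultimately show ?case
    unfolding image_Un by (rule emb.emb_attach)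
qed

lemma emb_attachI:
  assumes "emb R t y X" "emb R s z Z" "X \<inter> Z = {}" "R y z"
    and "\<And>u v. u \<in> X \<Longrightarrow> v \<in> Z \<Longrightarrow> R u v \<Longrightarrow> u = y \<and> v = z"
  shows "emb R (attach t s) y (X \<union> Z)"
  unfolding attach_def by (rule emb.emb_attach[OF _ assms(2-5)]) (use assms(1) in \<open>cases t; simp\<close>)

lemma emb_connected:
  assumes "emb R t y X" and "\<And>u v. u \<in> X \<Longrightarrow> v \<in> X \<Longrightarrow> R u v \<Longrightarrow> R v u"
    and "u \<in> X" "v \<in> X"
  shows "(\<lambda>a b. a \<in> X \<and> b \<in> X \<and> R a b)\<^sup>*\<^sup>* u v"
  using assms
proof (induction arbitrary: u v rule: emb.induct)
  case (emb_single y)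
  then have "u = y" "v = y" by blast+
  then show ?case by blast
next
  case (emb_attach ts y X t z Z)
  let ?r = "\<lambda>a b. a \<in> X \<union> Z \<and> b \<in> X \<union> Z \<and> R a b"
  have yX: "y \<in> X" and zZ: "z \<in> Z" using emb_attach.hyps emb_root by metis+
  have 1: "?r\<^sup>*\<^sup>* a b" if "a \<in> X" "b \<in> X" for a b
  proof -
    have "(\<lambda>a b. a \<in> X \<and> b \<in> X \<and> R a b)\<^sup>*\<^sup>* a b"
      by (rule emb_attach.IH(1)) (use that emb_attach.prems(1) in blast)+
    then show ?thesis by (rule rtranclp_mono[THEN predicate2D, rotated]) auto
  qed
  have 2: "?r\<^sup>*\<^sup>* a b" if "a \<in> Z" "b \<in> Z" for a b
  proof -
    have "(\<lambda>a b. a \<in> Z \<and> b \<in> Z \<and> R a b)\<^sup>*\<^sup>* a b"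
      by (rule emb_attach.IH(2)) (use that emb_attach.prems(1) in blast)+
    then show ?thesis by (rule rtranclp_mono[THEN predicate2D, rotated]) auto
  qed
  have yz: "?r\<^sup>*\<^sup>* y z" "?r\<^sup>*\<^sup>* z y"
    using yX zZ \<open>R y z\<close> emb_attach.prems(1)[of y z] by (simp_all add: r_into_rtranclp)
  have to_y: "?r\<^sup>*\<^sup>* a y" "?r\<^sup>*\<^sup>* y a" if a: "a \<in> X \<union> Z" for a
  proof -
    have "?r\<^sup>*\<^sup>* a y \<and> ?r\<^sup>*\<^sup>* y a"
    proof (cases "a \<in> X")
      case True
      then show ?thesis using 1 yX by blast
    next
      case False
      then have "?r\<^sup>*\<^sup>* a z" "?r\<^sup>*\<^sup>* z a" using 2 zZ a by blast+
      then show ?thesis using rtranclp_trans[OF _ yz(2)] rtranclp_trans[OF yz(1)] by blast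
    qed
    then show "?r\<^sup>*\<^sup>* a y" "?r\<^sup>*\<^sup>* y a" by blast+
  qed
  show ?case
    by (rule rtranclp_trans[OF to_y(1)[OF emb_attach.prems(2)] to_y(2)[OF emb_attach.prems(3)]])
qed

text \<open>Attaching a subtree adds exactly one edge, so vertices minus edges stays 1. Listing each
  edge with its smaller end first matches the count in \<open>ordered_tree\<close>.\<close>

lemma emb_edges:
  fixes X :: "'v :: linorder set"
  assumes "emb R t y X"
    and "\<And>u v. u \<in> X \<Longrightarrow> v \<in> X \<Longrightarrow> R u v \<Longrightarrow> R v u" and "\<And>u. u \<in> X \<Longrightarrow> \<not> R u u"
  shows "Suc (card {(u, v). u \<in> X \<and> v \<in> X \<and> u < v \<and> R u v}) = card X"
  using assms
proof (induction rule: emb.induct)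
  case (emb_single y)
  have "{(u, v). u \<in> {y} \<and> v \<in> {y} \<and> u < v \<and> R u v} = {}" by auto
  then have "card {(u, v). u \<in> {y} \<and> v \<in> {y} \<and> u < v \<and> R u v} = 0" by (metis card.empty)
  then show ?case by (metis card_1_singleton_iff One_nat_def)
next
  case (emb_attach ts y X t z Z)
  have yX: "y \<in> X" and zZ: "z \<in> Z" using emb_attach.hyps emb_root by metis+
  have fin: "finite X" "finite Z" using emb_attach.hyps emb_finite by metis+
  let ?P = "\<lambda>X. {(u, v). u \<in> X \<and> v \<in> X \<and> u < v \<and> R u v}"
  have "finite (?P X)" "finite (?P Z)"
    using fin by (auto intro: finite_subset[of _ "X \<times> X"] finite_subset[of _ "Z \<times> Z"])
  moreover have "?P (X \<union> Z) = insert (min y z, max y z) (?P X \<union> ?P Z)"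
  proof -
    have "R z y" using emb_attach.prems(1)[of y z] emb_attach.hyps(4) yX zZ by blast
    have "y \<noteq> z" using yX zZ emb_attach.hyps(3) by auto
    have "?P (X \<union> Z) \<subseteq> insert (min y z, max y z) (?P X \<union> ?P Z)"
    proof
      fix p assume "p \<in> ?P (X \<union> Z)"
      then obtain u v where p: "p = (u, v)" and uv: "u \<in> X \<union> Z" "v \<in> X \<union> Z" "u < v" "R u v"
        by blast
      consider "p \<in> ?P X \<union> ?P Z" | "u \<in> X" "v \<in> Z" | "v \<in> X" "u \<in> Z"
        using p uv by blast
      then show "p \<in> insert (min y z, max y z) (?P X \<union> ?P Z)"
      proof cases
        case 2
        then have "u = y \<and> v = z" using emb_attach.hyps(5) uv(4) by blast
        then show ?thesis using p uv(3) by auto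
      next
        case 3
        then have "v = y \<and> u = z" using emb_attach.hyps(5) emb_attach.prems(1)[OF uv(1,2,4)] by blast
        then show ?thesis using p uv(3) by auto
      qed blast
    qed
    moreover have "(min y z, max y z) \<in> ?P (X \<union> Z)"
      using \<open>R z y\<close> \<open>R y z\<close> \<open>y \<noteq> z\<close> yX zZ by (auto simp: min_def max_def)
    ultimately show ?thesis by blast
  qed
  moreover have "(min y z, max y z) \<notin> ?P X \<union> ?P Z"
    using yX zZ emb_attach.hyps(3) by (auto simp: min_def max_def split: if_splits)
  moreover have "?P X \<inter> ?P Z = {}" using emb_attach.hyps(3) by auto
  moreover have "Suc (card (?P X)) = card X" "Suc (card (?P Z)) = card Z"
    by (rule emb_attach.IH; use emb_attach.prems in blast)+
  ultimately show ?case
    using emb_attach.hyps(3) fin by (simp add: card_Un_disjoint)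
qed

lemma ordered_tree_emb:
  assumes "emb J t r {0..<n}"
    and sym: "\<And>u v. u < n \<Longrightarrow> v < n \<Longrightarrow> J u v \<longleftrightarrow> J v u" and irr: "\<And>u. u < n \<Longrightarrow> \<not> J u u"
  shows "ordered_tree n J"
proof -
  have eq: "(\<lambda>a b. a \<in> {0..<n} \<and> b \<in> {0..<n} \<and> J a b) = (\<lambda>x y. x < n \<and> y < n \<and> J x y)"
    by auto
  have conn: "(\<lambda>x y. x < n \<and> y < n \<and> J x y)\<^sup>*\<^sup>* u v" if "u < n" "v < n" for u v
    using emb_connected[OF assms(1), of u v] sym that unfolding eq
    by (metis atLeastLessThan_iff le0)
  have "{(u, v). u \<in> {0..<n} \<and> v \<in> {0..<n} \<and> u < v \<and> J u v} = {(u, v). u < v \<and> v < n \<and> J u v}"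
    by auto
  then have "Suc (card {(u, v). u < v \<and> v < n \<and> J u v}) = n"
    using emb_edges[OF assms(1)] sym irr by (metis (no_types, lifting) atLeastLessThan_iff card_atLeastLessThan minus_nat.diff_0)
  then show ?thesis
    unfolding ordered_tree_def using sym irr conn by (intro conjI allI impI) auto
qed

section \<open>The trees T(\<delta>, \<eta>) and their vertices as words\<close>

fun dtree :: "nat \<Rightarrow> nat \<Rightarrow> rtree" where
  "dtree \<delta> 0 = Node []"
| "dtree \<delta> (Suc k) = Node (replicate \<delta> (dtree \<delta> k))"

lemma tsize_replicate: "tsize (Node (replicate i t)) = Suc (i * tsize t)"
  by (simp add: sum_list_replicate)

text \<open>The extra \<open>Suc\<close> lets the induction close: for a subtree of size s, 2 +
  \<delta> s \<le> \<delta> (s + 1) because \<delta> \<ge> 2.\<close>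

lemma tsize_dtree:
  assumes "\<delta> \<ge> 2"
  shows "Suc (tsize (dtree \<delta> k)) \<le> \<delta> ^ Suc k"
proof (induction k)
  case 0
  then show ?case using assms by simp
next
  case (Suc k)
  have "\<delta> * Suc (tsize (dtree \<delta> k)) \<le> \<delta> * \<delta> ^ Suc k" using Suc mult_le_mono2 by blast
  then show ?case using assms by (simp add: sum_list_replicate)
qed

text \<open>Children are numbered from the end of the list, so that attaching a further child
  leaves the words of the other vertices unchanged.\<close>
fun words :: "rtree \<Rightarrow> nat list set" where
  "words (Node []) = {[]}"
| "words (Node (t # ts)) = words (Node ts) \<union> (#) (length ts) ` words t"

lemma Nil_in_words [simp]: "[] \<in> words t"
  by (induction t rule: words.induct) auto

lemma words_head_less: "i # a \<in> words (Node ts) \<Longrightarrow> i < length ts"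
  by (induction ts) auto

lemma words_replicate: "words (Node (replicate n t)) = insert [] (\<Union>i<n. (#) i ` words t)"
  by (induction n) (auto simp: lessThan_Suc)

lemma words_dtree: "words (dtree \<delta> k) = T_verts \<delta> k"
proof (induction k)
  case 0
  then show ?case by (auto simp: T_verts_def)
next
  case (Suc k)
  have "xs \<in> insert [] (\<Union>i<\<delta>. (#) i ` T_verts \<delta> k) \<longleftrightarrow> xs \<in> T_verts \<delta> (Suc k)" for xs
    by (cases xs) (auto simp: T_verts_def)
  then show ?case using Suc by (auto simp: words_replicate)
qed

lemma T_adj_Cons [simp]: "T_adj (i # xs) (j # ys) \<longleftrightarrow> i = j \<and> T_adj xs ys"
  by (auto simp: T_adj_def)

lemma T_adj_Nil_Cons [simp]: "T_adj [] (i # xs) \<longleftrightarrow> xs = []" "T_adj (i # xs) [] \<longleftrightarrow> xs = []"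
  by (auto simp: T_adj_def)

lemma T_adj_Nil [simp]: "\<not> T_adj [] []"
  by (simp add: T_adj_def)

text \<open>Produces the injection asked for by \<open>contains\<close>. The words of the last
  attached subtree begin with \<open>length ts\<close>, a letter that starts no word of
  \<open>Node ts\<close>, so the maps for the two parts can be glued.\<close>

lemma emb_words:
  assumes "emb R t y X"
    and "\<And>u v. u \<in> X \<Longrightarrow> v \<in> X \<Longrightarrow> R u v \<Longrightarrow> R v u" and "\<And>u. u \<in> X \<Longrightarrow> \<not> R u u"
  shows "\<exists>f. inj_on f (words t) \<and> f ` words t = X \<and> f [] = y \<and>
    (\<forall>a\<in>words t. \<forall>b\<in>words t. T_adj a b \<longleftrightarrow> R (f a) (f b))"
  using assms
proof (induction rule: emb.induct)
  case (emb_single y)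
  then show ?case by (intro exI[of _ "\<lambda>_. y"]) auto
next
  case (emb_attach ts y X t z Z)
  obtain f where f: "inj_on f (words (Node ts))" "f ` words (Node ts) = X" "f [] = y"
    "\<And>a b. a \<in> words (Node ts) \<Longrightarrow> b \<in> words (Node ts) \<Longrightarrow> T_adj a b \<longleftrightarrow> R (f a) (f b)"
    using emb_attach.IH(1) emb_attach.prems by (metis UnCI)
  obtain g where g: "inj_on g (words t)" "g ` words t = Z" "g [] = z"
    "\<And>a b. a \<in> words t \<Longrightarrow> b \<in> words t \<Longrightarrow> T_adj a b \<longleftrightarrow> R (g a) (g b)"
    using emb_attach.IH(2) emb_attach.prems by (metis UnCI)
  define n where "n = length ts"
  define h where "h a = (if a \<noteq> [] \<and> hd a = n then g (tl a) else f a)" for a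
  have hf: "h a = f a" if "a \<in> words (Node ts)" for a
    using that words_head_less by (cases a) (auto simp: h_def n_def)
  have hg: "h (n # a) = g a" for a by (simp add: h_def)
  have nX: "i \<noteq> n" if "i # a \<in> words (Node ts)" for i a
    using that words_head_less by (auto simp: n_def)
  have W: "words (Node (t # ts)) = words (Node ts) \<union> (#) n ` words t"
    by (simp only: words.simps n_def)
  have "h ` words (Node ts) = X" using f(2) hf by (metis image_cong)
  moreover have "h ` (#) n ` words t = Z" using g(2) by (simp add: hg image_image)
  moreover have "inj_on h (words (Node ts))" using f(1) hf by (metis inj_on_cong)
  moreover have "inj_on h ((#) n ` words t)" using g(1) by (auto simp: inj_on_def hg)
  ultimately have "inj_on h (words (Node (t # ts)))" "h ` words (Node (t # ts)) = X \<union> Z"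
    unfolding W inj_on_Un image_Un using emb_attach.hyps(3) by blast+
  moreover have "h [] = y" using f(3) by (simp add: h_def)
  moreover have "T_adj a b \<longleftrightarrow> R (h a) (h b)"
    if "a \<in> words (Node (t # ts))" "b \<in> words (Node (t # ts))" for a b
  proof -
    \<comment> \<open>Across the two parts both relations hold for the pair of roots alone, that is
      for \<open>[]\<close> and \<open>[n]\<close>.\<close>
    have cross: "(T_adj a (n # c) \<longleftrightarrow> R (f a) (g c)) \<and> (T_adj (n # c) a \<longleftrightarrow> R (g c) (f a))"
      if a: "a \<in> words (Node ts)" and c: "c \<in> words t" for a c
    proof -
      have "f a \<in> X" "g c \<in> Z" using a c f(2) g(2) by blast+
      then have s: "R (g c) (f a) \<longleftrightarrow> R (f a) (g c)"
        using emb_attach.prems(1) by blast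
      have "R (f a) (g c) \<longleftrightarrow> f a = y \<and> g c = z"
        using emb_attach.hyps(4,5) \<open>f a \<in> X\<close> \<open>g c \<in> Z\<close> by blast
      also have "f a = y \<longleftrightarrow> a = []"
        using f(1,3) a Nil_in_words[of "Node ts"] by (metis inj_onD)
      also have "g c = z \<longleftrightarrow> c = []"
      proof -
        show ?thesis using g(1,3) c Nil_in_words[of t] by (metis inj_onD)
      qed
      finally have "R (f a) (g c) \<longleftrightarrow> a = [] \<and> c = []" .
      moreover have "T_adj a (n # c) \<longleftrightarrow> a = [] \<and> c = []" "T_adj (n # c) a \<longleftrightarrow> a = [] \<and> c = []"
        using a nX by (cases a; auto)+
      ultimately show ?thesis using s by blast
    qed
    show ?thesis
      using that unfolding W by (elim UnE imageE) (simp_all add: hf hg f(4) g(4) cross)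
  qed
  ultimately show ?case by blast
qed

text \<open>The side \<open>True\<close> stands for the left end of a support, \<open>False\<close> for the right end.\<close>
definition ext :: "bool \<Rightarrow> int set \<Rightarrow> int" where
  "ext p S = (if p then Min S else Max S)"

lemma ex_strict_mono_enum:
  fixes S :: "int set"
  assumes "finite S"
  obtains g where "strict_mono_on {0..<card S} g" "g ` {0..<card S} = S"
proof -
  let ?l = "sorted_list_of_set S"
  have len: "length ?l = card S" by simp
  have "strict_mono_on {0..<card S} ((!) ?l)"
    using strict_sorted_list_of_set[of S] len
    by (auto simp: strict_mono_on_def sorted_wrt_iff_nth_less)
  moreover have "(!) ?l ` {0..<card S} = S"
    using assms len by (metis list.set_map map_nth set_sorted_list_of_set set_upt)
  ultimately show ?thesis using that by blast
qed

lemma strict_mono_on_ext: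
  fixes n :: nat
  assumes "strict_mono_on {0..<n} g" "n \<ge> 1"
  shows "g (if p then 0 else n - 1) = ext p (g ` {0..<n})"
proof -
  have mono: "g i \<le> g j" if "i \<le> j" "j < n" for i j
  proof (cases "i = j")
    case False
    then have "g i < g j" by (intro strict_mono_onD[OF assms(1)]) (use that in auto)
    then show ?thesis by simp
  qed simp
  have "Min (g ` {0..<n}) = g 0"
    using assms(2) mono by (intro Min_eqI) auto
  moreover have "Max (g ` {0..<n}) = g (n - 1)"
    using assms(2) mono by (intro Max_eqI) auto
  ultimately show ?thesis by (simp add: ext_def)
qed

lemma sum_card_swap:
  assumes "finite A" "finite B"
  shows "(\<Sum>a\<in>A. card {b \<in> B. R a b}) = (\<Sum>b\<in>B. card {a \<in> A. R a b})"
  using sum_multicount_gen[OF assms, of R "\<lambda>b. card {a \<in> A. R a b}"] by simp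

section \<open>Trees realised with their root at an end of the support\<close>

text \<open>The setting of the theorem with \<open>\<kappa>\<close> in place of 2^(-9\<delta>). The
  lower bound on the width turns the threshold \<epsilon>|G| of coherence into
  \<open>\<kappa> * w\<close>, which gives \<open>deg_small\<close> and
  \<open>linked\<close>.\<close>

locale uniform_blockade =
  fixes V :: "'a set" and E :: "'a \<Rightarrow> 'a \<Rightarrow> bool" and I :: "int set" and B :: "int \<Rightarrow> 'a set"
    and w \<tau> :: nat and \<kappa> lam :: real
  assumes graph: "graph V E"
    and finite_I: "finite I"
    and block_sub: "i \<in> I \<Longrightarrow> B i \<subseteq> V"
    and block_card: "i \<in> I \<Longrightarrow> card (B i) = w"
    and block_disj: "i \<in> I \<Longrightarrow> j \<in> I \<Longrightarrow> i \<noteq> j \<Longrightarrow> B i \<inter> B j = {}"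
    and w_pos: "w > 0"
    and width: "bwidth I B = w"
    and deg_small: "v \<in> V \<Longrightarrow> real (card {u \<in> V. E v u}) < \<kappa> * w"
    and linked: "P \<subseteq> V \<Longrightarrow> Q \<subseteq> V \<Longrightarrow> P \<inter> Q = {} \<Longrightarrow> \<kappa> * w \<le> card P \<Longrightarrow> \<kappa> * w \<le> card Q \<Longrightarrow>
      \<exists>u\<in>P. \<exists>v\<in>Q. E u v"
    and kappa: "0 < \<kappa>" "\<kappa> \<le> 1 / 1000"
    and lam: "0 < lam" "lam * \<tau> \<le> \<kappa>"
    and tau: "\<tau> \<ge> 1"
    and conc: "concave E lam I B"
    and unif: "support_uniform E \<tau> I B"
    and inv: "support_invariant E \<kappa> \<tau> I B"
begin

lemma E_sym: "u \<in> V \<Longrightarrow> v \<in> V \<Longrightarrow> E u v \<longleftrightarrow> E v u"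
  using graph by (auto simp: graph_def)

lemma E_irrefl: "v \<in> V \<Longrightarrow> \<not> E v v"
  using graph by (auto simp: graph_def)

lemma finite_V: "finite V"
  using graph by (auto simp: graph_def)

lemma finite_block: "i \<in> I \<Longrightarrow> finite (B i)"
  using block_sub finite_V finite_subset by blast

lemma card_block_Diff: "i \<in> I \<Longrightarrow> A \<subseteq> B i \<Longrightarrow> card (B i - A) = w - card A"
  by (metis card_Diff_subset block_card finite_block finite_subset)

text \<open>A copy of the tree is recorded by its transversal \<open>x\<close> of the blocks in the support, so that
  the copy lives on the index set itself.\<close>
definition realised :: "bool \<Rightarrow> rtree \<Rightarrow> bool" where
  "realised p t \<longleftrightarrow> (\<forall>S C. S \<subseteq> I \<longrightarrow> card S = tsize t \<longrightarrow>
     (\<forall>i\<in>S. C i \<subseteq> B i \<and> \<kappa> * w \<le> card (C i)) \<longrightarrow>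
     (\<exists>x. (\<forall>i\<in>S. x i \<in> C i) \<and> emb (\<lambda>i j. E (x i) (x j)) t (ext p S) S))"

text \<open>A single copy suffices. It makes the trace of the ordered tree it induces nonempty,
  uniformity then yields every support of that size, and invariance keeps these supports when the
  blocks shrink to a proportion \<open>\<kappa>\<close>.\<close>

lemma realisedI:
  assumes S: "S \<subseteq> I" "card S \<le> \<tau>" and x: "\<And>i. i \<in> S \<Longrightarrow> x i \<in> B i"
    and emb: "emb (\<lambda>i j. E (x i) (x j)) t (ext p S) S"
  shows "realised p t"
  unfolding realised_def
proof (intro allI impI)
  fix S' C assume S': "S' \<subseteq> I" "card S' = tsize t"
    and C: "\<forall>i\<in>S'. C i \<subseteq> B i \<and> \<kappa> * w \<le> card (C i)"
  define n where "n = tsize t"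
  have cS: "card S = n" using emb_card[OF emb] by (simp add: n_def)
  have n1: "n \<ge> 1" unfolding n_def by (cases t) simp
  have fS: "finite S" "finite S'" using S S' finite_I finite_subset by blast+
  define r where "r = (if p then 0 else n - 1)"
  have rn: "r \<in> {0..<n}" using n1 by (auto simp: r_def)
  obtain g where g: "strict_mono_on {0..<n} g" "g ` {0..<n} = S"
    using ex_strict_mono_enum[OF fS(1)] cS by metis
  have gI: "k < n \<Longrightarrow> g k \<in> S" for k using g(2) by auto
  have injg: "inj_on g {0..<n}" using g(1) strict_mono_on_imp_inj_on by blast
  have gr: "g r = ext p S" using strict_mono_on_ext[OF g(1) n1] g(2) by (simp add: r_def)
  define J where "J k l \<longleftrightarrow> E (x (g k)) (x (g l))" for k l
  have xV: "k < n \<Longrightarrow> x (g k) \<in> V" for k using gI x block_sub S(1) by blast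
  let ?h = "inv_into {0..<n} g"
  have "emb J t (?h (ext p S)) (?h ` S)"
  proof (rule emb_map[OF emb])
    show "inj_on ?h S" using g(2) inj_on_inv_into by blast
    show "J (?h u) (?h v) \<longleftrightarrow> E (x u) (x v)" if "u \<in> S" "v \<in> S" for u v
      using that g(2) by (simp add: J_def f_inv_into_f)
  qed
  moreover have "?h ` S = {0..<n}" using g(2) injg by (metis inv_into_image_cancel subset_refl)
  moreover have "?h (ext p S) = r" using gr injg rn by (metis inv_into_f_f)
  ultimately have embJ: "emb J t r {0..<n}" by simp
  have ord: "ordered_tree n J"
    by (rule ordered_tree_emb[OF embJ]) (use E_sym E_irrefl xV in \<open>auto simp: J_def\<close>)
  have n\<tau>: "n \<le> \<tau>" using S(2) cS by simp
  have "S \<in> trace E I B n J"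
    unfolding trace_def
  proof (intro CollectI exI[of _ g] exI[of _ "\<lambda>k. x (g k)"] conjI)
    show "\<forall>k<n. x (g k) \<in> B (g k)" using x gI by blast
  qed (use g S(1) in \<open>auto simp: J_def\<close>)
  then have full: "trace E I B n J = {S. S \<subseteq> I \<and> card S = n}"
    using unif ord n\<tau> unfolding support_uniform_def by blast
  \<comment> \<open>Only the blocks of the wanted support are shrunk; the others stay whole, so the
    contraction still has width at least \<open>\<kappa> * w\<close>.\<close>
  define B' where "B' i = (if i \<in> S' then C i else B i)" for i
  have ge: "\<kappa> * w \<le> card (B' i)" "B' i \<subseteq> B i" if "i \<in> I" for i
    using C kappa that block_card by (auto simp: B'_def mult_left_le_one_le)
  have ne: "B' i \<noteq> {}" if "i \<in> I" for i
  proof -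
    have "0 < \<kappa> * w" using kappa w_pos by simp
    then have "card (B' i) \<noteq> 0" using ge(1)[OF that] by auto
    then show ?thesis by auto
  qed
  have contr: "contraction I B B'" using ge ne by (auto simp: contraction_def)
  have "S' \<noteq> {}" using S' n1 by (auto simp: n_def)
  then have I0: "I \<noteq> {}" using S' by auto
  then have "bwidth I B' \<in> (\<lambda>i. card (B' i)) ` I"
    unfolding bwidth_def using finite_I by (intro Min_in) auto
  then have "\<kappa> * bwidth I B \<le> bwidth I B'" using ge(1) width by auto
  then have "trace E I B' n J = trace E I B n J"
    using inv contr ord n\<tau> unfolding support_invariant_def by metis
  then have "S' \<in> trace E I B' n J" using full S' by (simp add: n_def)
  then obtain g' f where g': "S' = g' ` {0..<n}" "strict_mono_on {0..<n} g'"
    and f: "\<forall>k<n. f k \<in> B' (g' k)"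
    and Jf: "\<forall>k<n. \<forall>l<n. k \<noteq> l \<longrightarrow> (J k l \<longleftrightarrow> E (f k) (f l))"
    unfolding trace_def by blast
  have injg': "inj_on g' {0..<n}" using g'(2) strict_mono_on_imp_inj_on by blast
  have g'r: "g' r = ext p S'" using strict_mono_on_ext[OF g'(2) n1] g'(1) by (simp add: r_def)
  define x' where "x' i = f (inv_into {0..<n} g' i)" for i
  have x'g: "x' (g' k) = f k" if "k < n" for k using that injg' by (simp add: x'_def inv_into_f_f)
  have x'C: "x' i \<in> C i" if "i \<in> S'" for i
  proof -
    have "i \<in> g' ` {0..<n}" using that g'(1) by simp
    then obtain k where "k < n" "i = g' k" by auto
    then have "f k \<in> B' i" using f by blast
    then show ?thesis using x'g[OF \<open>k < n\<close>] \<open>i = g' k\<close> that by (simp add: B'_def)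
  qed
  have "emb (\<lambda>i j. E (x' i) (x' j)) t (g' r) (g' ` {0..<n})"
  proof (rule emb_map[OF embJ injg'])
    fix k l assume kl: "k \<in> {0..<n}" "l \<in> {0..<n}"
    show "E (x' (g' k)) (x' (g' l)) \<longleftrightarrow> J k l"
    proof (cases "k = l")
      \<comment> \<open>The trace fixes adjacency for \<open>k \<noteq> l\<close> only; on the
        diagonal both sides are false by irreflexivity.\<close>
      case True
      have "f k \<in> V" using x'C[of "g' k"] x'g[of k] kl g'(1) C block_sub S'(1) by fastforce
      then show ?thesis using True kl x'g E_irrefl xV[of k] by (simp add: J_def)
    next
      case False
      then show ?thesis using kl x'g Jf by simp
    qed
  qed
  then show "\<exists>x. (\<forall>i\<in>S'. x i \<in> C i) \<and> emb (\<lambda>i j. E (x i) (x j)) t (ext p S') S'"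
    using x'C g'r g'(1) by metis
qed

lemma realised_leaf:
  assumes "I \<noteq> {}"
  shows "realised p (Node [])"
proof -
  obtain i where i: "i \<in> I" using assms by blast
  obtain v where "v \<in> B i" using block_card[OF i] w_pos by fastforce
  then show ?thesis
    using i tau emb_single[of "\<lambda>i j. E v v" i]
    by (intro realisedI[of "{i}" "\<lambda>_. v"]) (auto simp: ext_def)
qed

text \<open>The joining edge has both roots as ends, so either tree may be regarded as hung on the
  other. Both rootings are kept because the mixed case of the trichotomy needs them
  simultaneously.\<close>

lemma merged_emb:
  assumes S: "S \<subseteq> I" "S' \<subseteq> I" "S \<inter> S' = {}"
    and x: "\<And>i. i \<in> S \<Longrightarrow> x i \<in> B i" and x': "\<And>i. i \<in> S' \<Longrightarrow> x' i \<in> B i"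
    and t: "emb (\<lambda>i j. E (x i) (x j)) t a S" and s: "emb (\<lambda>i j. E (x' i) (x' j)) s b S'"
    and e: "E (x a) (x' b)"
    and only: "\<And>i j. i \<in> S \<Longrightarrow> j \<in> S' \<Longrightarrow> E (x i) (x' j) \<Longrightarrow> i = a \<and> j = b"
  defines "z \<equiv> \<lambda>i. if i \<in> S then x i else x' i"
  shows "emb (\<lambda>i j. E (z i) (z j)) (attach t s) a (S \<union> S')"
    and "emb (\<lambda>i j. E (z i) (z j)) (attach s t) b (S \<union> S')"
proof -
  have t': "emb (\<lambda>i j. E (z i) (z j)) t a S"
    using emb_map[OF t, of id "\<lambda>i j. E (z i) (z j)"] by (simp add: z_def)
  have zS': "z i = x' i" if "i \<in> S'" for i using that S(3) by (auto simp: z_def)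
  have s': "emb (\<lambda>i j. E (z i) (z j)) s b S'"
    using emb_map[OF s, of id "\<lambda>i j. E (z i) (z j)"] by (simp add: zS')
  have zz: "E (z j) (z i) \<longleftrightarrow> E (x i) (x' j)" "E (z i) (z j) \<longleftrightarrow> E (x i) (x' j)" if "i \<in> S" "j \<in> S'" for i j
  proof -
    have "x i \<in> V" "x' j \<in> V" using that x x' block_sub S by blast+
    then show "E (z j) (z i) \<longleftrightarrow> E (x i) (x' j)" "E (z i) (z j) \<longleftrightarrow> E (x i) (x' j)"
      using that zS' E_sym by (auto simp: z_def)
  qed
  have a: "a \<in> S" and b: "b \<in> S'" using t s emb_root by metis+
  show "emb (\<lambda>i j. E (z i) (z j)) (attach t s) a (S \<union> S')"
    by (rule emb_attachI[OF t' s' S(3)]) (use zz a b e only in metis)+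
  have "emb (\<lambda>i j. E (z i) (z j)) (attach s t) b (S' \<union> S)"
    by (rule emb_attachI[OF s' t']) (use zz a b e only S(3) in \<open>metis Int_commute\<close>)+
  then show "emb (\<lambda>i j. E (z i) (z j)) (attach s t) b (S \<union> S')"
    by (simp add: Un_commute)
qed

lemma lam_small: "lam \<le> 1 / 1000"
proof -
  have "lam * 1 \<le> lam * \<tau>" using lam tau by (intro mult_left_mono) auto
  then show ?thesis using lam(2) kappa(2) by linarith
qed

lemma kappa_w: "\<kappa> * w \<le> w / 1000"
  using mult_right_mono[OF kappa(2), of w] by simp

lemma lam_w: "lam * w \<le> w / 1000"
  using mult_right_mono[OF lam_small, of w] by simp

text \<open>Vertices of \<open>D\<close> have on average so many more neighbours in \<open>W\<close>
  than those of \<open>Q\<close> can compensate for, up to a factor of order \<open>\<tau>\<close>,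
  that some vertex of \<open>W\<close> always covers the rest of \<open>D\<close> efficiently.
  Adding such vertices reaches \<open>lam * w\<close> in \<open>D\<close> while the part of
  \<open>Q\<close> covered is still small.\<close>

lemma greedy_cover:
  assumes sub: "W \<subseteq> V" "D \<subseteq> V" "Q \<subseteq> V"
    and D: "real w / 8 \<le> card D" "\<And>z. z \<in> D \<Longrightarrow> d < 4 * \<tau> * card {u \<in> W. E z u}"
    and Q: "card Q \<le> 2 * w" "\<And>q. q \<in> Q \<Longrightarrow> card {u \<in> W. E q u} \<le> d"
  obtains X where "X \<subseteq> W" "lam * w \<le> card {z \<in> D. \<exists>u\<in>X. E z u}"
    "card {q \<in> Q. \<exists>u\<in>X. E q u} \<le> real w / 4"
proof -
  have fin: "finite W" "finite D" "finite Q" using sub finite_V finite_subset by blast+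
  define nb where "nb X Y = {z \<in> Y. \<exists>u\<in>X. E z u}" for X Y
  \<comment> \<open>The factor is a ratio of edge counts: at least w/16 uncovered vertices of
    \<open>D\<close> of degree above d/(4\<tau>) send more than wd/(64\<tau>) edges to
    \<open>W\<close>, whereas \<open>Q\<close> sends at most 2wd.\<close>
  define \<F> where "\<F> = {X. X \<subseteq> W \<and> card (nb X Q) \<le> 128 * \<tau> * card (nb X D) \<and> card (nb X D) < lam * w}"
  have "finite \<F>" using fin(1) by (auto simp: \<F>_def intro: finite_subset[of _ "Pow W"])
  moreover have "{} \<in> \<F>" using lam w_pos by (simp add: \<F>_def nb_def)
  ultimately obtain X where X: "X \<in> \<F>" and max: "\<And>Y. Y \<in> \<F> \<Longrightarrow> X \<subseteq> Y \<Longrightarrow> X = Y"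
    using finite_has_maximal[of \<F>] by blast
  define UD where "UD = D - nb X D"
  define UQ where "UQ = Q - nb X Q"
  have finU: "finite UD" "finite UQ" using fin by (auto simp: UD_def UQ_def)
  have "card (nb X D) < lam * w" using X by (simp add: \<F>_def)
  moreover note lam_w
  moreover have "card D \<le> card UD + card (nb X D)"
  proof -
    have "D = UD \<union> nb X D" by (auto simp: UD_def nb_def)
    then show ?thesis using card_Un_le[of UD "nb X D"] by simp
  qed
  moreover have "real w > 0" using w_pos by simp
  ultimately have cUD: "real w / 16 \<le> card UD"
    using D(1) by linarith
  then have UD0: "UD \<noteq> {}" using w_pos by auto
  have "card UD * d < (\<Sum>z\<in>UD. 4 * \<tau> * card {u \<in> W. E z u})"
    using sum_strict_mono[OF finU(1) UD0, of "\<lambda>_. d"] D(2) by (simp add: UD_def)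
  then have lower: "card UD * d < 4 * \<tau> * (\<Sum>u\<in>W. card {z \<in> UD. E z u})"
    using sum_card_swap[OF finU(1) fin(1), of E] by (simp flip: sum_distrib_left)
  have "(\<Sum>q\<in>UQ. card {u \<in> W. E q u}) \<le> card UQ * d"
    using sum_bounded_above[of UQ "\<lambda>q. card {u \<in> W. E q u}" d] Q(2) by (simp add: UQ_def)
  also have "\<dots> \<le> 2 * w * d"
    using Q(1) card_mono[OF fin(3), of UQ] by (intro mult_right_mono) (auto simp: UQ_def)
  finally have upper: "(\<Sum>u\<in>W. card {q \<in> UQ. E q u}) \<le> 2 * w * d"
    using sum_card_swap[OF finU(2) fin(1), of E] by simp
  have "\<exists>u\<in>W. card {q \<in> UQ. E q u} < 128 * \<tau> * card {z \<in> UD. E z u}"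
  proof (rule ccontr)
    assume "\<not> ?thesis"
    then have "(\<Sum>u\<in>W. 128 * \<tau> * card {z \<in> UD. E z u}) \<le> (\<Sum>u\<in>W. card {q \<in> UQ. E q u})"
      by (intro sum_mono) (auto simp: not_less)
    moreover have "(\<Sum>u\<in>W. 128 * \<tau> * card {z \<in> UD. E z u}) =
        32 * (4 * \<tau> * (\<Sum>u\<in>W. card {z \<in> UD. E z u}))"
      by (simp add: sum_distrib_left mult.assoc)
    ultimately have "32 * (4 * \<tau> * (\<Sum>u\<in>W. card {z \<in> UD. E z u})) \<le> 2 * w * d"
      using upper by linarith
    then have "32 * (card UD * d) < 2 * w * d" using lower by linarith
    moreover have "w \<le> 16 * card UD" using cUD by linarith
    then have "2 * w * d \<le> 32 * (card UD * d)"
      using mult_right_mono[of w "16 * card UD" "2 * d"] by (simp add: algebra_simps)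
    ultimately show False by linarith
  qed
  then obtain u where u: "u \<in> W" "card {q \<in> UQ. E q u} < 128 * \<tau> * card {z \<in> UD. E z u}"
    by blast
  then have ne: "{z \<in> UD. E z u} \<noteq> {}" by fastforce
  define Y where "Y = insert u X"
  have split: "nb Y D = nb X D \<union> {z \<in> UD. E z u}" "nb Y Q = nb X Q \<union> {q \<in> UQ. E q u}"
    by (auto simp: nb_def Y_def UD_def UQ_def)
  have finnb: "finite (nb X D)" "finite (nb X Q)" using fin by (auto simp: nb_def)
  have cD: "card (nb Y D) = card (nb X D) + card {z \<in> UD. E z u}"
    unfolding split using finnb finU by (intro card_Un_disjoint) (auto simp: UD_def)
  have cQ: "card (nb Y Q) = card (nb X Q) + card {q \<in> UQ. E q u}"
    unfolding split using finnb finU by (intro card_Un_disjoint) (auto simp: UQ_def)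
  have YW: "Y \<subseteq> W" using u X by (auto simp: Y_def \<F>_def)
  have rX: "card (nb X Q) \<le> 128 * \<tau> * card (nb X D)" using X by (simp add: \<F>_def)
  have rY: "card (nb Y Q) \<le> 128 * \<tau> * card (nb Y D)"
    unfolding cD cQ using rX u(2) by (simp add: algebra_simps)
  have "u \<notin> X" using ne by (auto simp: UD_def nb_def)
  \<comment> \<open>The larger set \<open>Y\<close> still obeys the ratio, so it can have left
    \<open>\<F>\<close> only by reaching the threshold \<open>lam * w\<close>.\<close>
  then have "Y \<notin> \<F>" using max[of Y] by (auto simp: Y_def)
  then have 1: "lam * w \<le> card (nb Y D)" using YW rY by (auto simp: \<F>_def)
  \<comment> \<open>The last vertex covers fewer than \<open>\<kappa> * w\<close> new vertices of
    \<open>Q\<close>, and \<open>X\<close> covered at most \<open>128 * \<kappa> * w\<close>;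
    together this is below w/4.\<close>
  have "{q \<in> UQ. E q u} \<subseteq> {v \<in> V. E u v}"
    using u(1) sub E_sym unfolding UQ_def by blast
  then have "card {q \<in> UQ. E q u} \<le> card {v \<in> V. E u v}"
    using finite_V by (intro card_mono) simp_all
  moreover have "card {v \<in> V. E u v} < \<kappa> * w" using deg_small u(1) sub by blast
  ultimately have "real (card {q \<in> UQ. E q u}) < \<kappa> * w" by linarith
  moreover have "real (card (nb X Q)) \<le> 128 * \<kappa> * w"
  proof -
    have "real (card (nb X Q)) \<le> real (128 * \<tau> * card (nb X D))" using rX by (simp only: of_nat_le_iff)
    also have "\<dots> = 128 * real \<tau> * real (card (nb X D))" by simp
    also have "\<dots> \<le> 128 * real \<tau> * (lam * w)"
      using X by (intro mult_left_mono) (auto simp: \<F>_def)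
    also have "\<dots> = 128 * (lam * \<tau>) * w" by simp
    also have "\<dots> \<le> 128 * \<kappa> * w" using lam by (intro mult_right_mono mult_left_mono) auto
    finally show ?thesis .
  qed
  moreover note kappa_w
  ultimately have 2: "card (nb Y Q) \<le> real w / 4" unfolding cQ by simp
  show ?thesis using that[OF YW] 1 2 by (simp add: nb_def)
qed

end

section \<open>Merging two trees by an edge between their roots\<close>

text \<open>The end blocks in their order are \<open>tgt True\<close>, \<open>src True\<close>, \<open>src False\<close>, \<open>tgt False\<close>. A copy of
  \<open>ch p q\<close> rooted in \<open>src p\<close> is meant to be hung on a vertex of \<open>tgt q\<close>.\<close>
locale frame = uniform_blockade +
  fixes src tgt :: "bool \<Rightarrow> int" and M :: "int set"
    and ch :: "bool \<Rightarrow> bool \<Rightarrow> rtree" and Q :: "bool \<Rightarrow> bool \<Rightarrow> int set"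
  assumes tgt_I: "tgt q \<in> I" and src_I: "src p \<in> I" and M_I: "M \<subseteq> I"
    and order: "tgt True < src True" "src True < src False" "src False < tgt False"
      "\<And>m. m \<in> M \<Longrightarrow> src True < m \<and> m < src False"
    and Q_M: "Q p q \<subseteq> M" and Q_disj: "Q p True \<inter> Q p False = {}"
    and Q_card: "card (insert (src p) (Q p q)) = tsize (ch p q)"
    and ch_size: "tsize (ch p q) \<le> \<tau>"
    and ch_real: "realised p (ch p q)"
begin

definition nodes :: "bool \<Rightarrow> int set" where
  "nodes p = Q p True \<union> Q p False"

text \<open>A joint copy carries both trees prescribed for its source block: which of the two is needed
  depends on the target block that gets covered first.\<close>
definition joint :: "bool \<Rightarrow> (int \<Rightarrow> 'a) \<Rightarrow> bool" where
  "joint p x \<longleftrightarrow> (\<forall>i\<in>insert (src p) (nodes p). x i \<in> B i) \<and>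
     (\<forall>q. emb (\<lambda>i j. E (x i) (x j)) (ch p q) (src p) (insert (src p) (Q p q)))"

lemma finite_M: "finite M" using M_I finite_I finite_subset by blast

lemma finite_Q: "finite (Q p q)" using Q_M finite_M finite_subset by blast

lemma nodes_M: "nodes p \<subseteq> M" using Q_M by (auto simp: nodes_def)

lemma src_notin_M: "src p \<notin> M"
proof (cases p)
  case True
  then show ?thesis using order(4)[of "src p"] by auto
next
  case False
  then show ?thesis using order(4)[of "src p"] by auto
qed

lemma tgt_ends: "i \<in> insert (src p) M \<Longrightarrow> tgt True < i \<and> i < tgt False"
  using order(1-3) order(4)[of i] by (cases p) auto

lemma ext_src: "S \<subseteq> M \<Longrightarrow> ext p (insert (src p) S) = src p"
proof -
  assume S: "S \<subseteq> M"
  then have fin: "finite S" using finite_M finite_subset by blast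
  show ?thesis
  proof (cases p)
    case True
    then show ?thesis using fin S order(4)
      unfolding ext_def by (auto intro!: Min_eqI simp: less_imp_le subset_iff)
  next
    case False
    then show ?thesis using fin S order(4)
      unfolding ext_def by (auto intro!: Max_eqI simp: less_imp_le subset_iff)
  qed
qed

lemma card_nodes: "card (nodes p) \<le> 2 * \<tau>"
proof -
  have "card (Q p q) \<le> \<tau>" for q
    using Q_card[of p q] ch_size[of p q] finite_Q[of p q] by (metis card_insert_le order_trans)
  then show ?thesis unfolding nodes_def
    by (metis add_mono card_Un_le mult_2 order_trans)
qed

text \<open>\<open>src p\<close> lies beyond all of \<open>M\<close> on side \<open>p\<close>, so it
  is the end of the support where the root belongs, and shrinking its block to \<open>Y\<close>
  prescribes where the root is found.\<close>

lemma child_exists: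
  assumes C: "\<And>m. m \<in> nodes p \<Longrightarrow> C m \<subseteq> B m \<and> \<kappa> * w \<le> card (C m)"
    and Y: "Y \<subseteq> B (src p)" "\<kappa> * w \<le> card Y"
  shows "\<exists>x. x (src p) \<in> Y \<and> (\<forall>m\<in>Q p q. x m \<in> C m) \<and>
    emb (\<lambda>i j. E (x i) (x j)) (ch p q) (src p) (insert (src p) (Q p q))"
proof -
  let ?S = "insert (src p) (Q p q)"
  let ?C = "C(src p := Y)"
  have n: "src p \<notin> Q p q" using src_notin_M Q_M by blast
  have "Q p q \<subseteq> nodes p" by (cases q) (auto simp: nodes_def)
  then have "\<forall>i\<in>?S. ?C i \<subseteq> B i \<and> \<kappa> * w \<le> card (?C i)" using C Y by auto
  moreover have "?S \<subseteq> I" using src_I Q_M M_I by blast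
  ultimately obtain x where "\<forall>i\<in>?S. x i \<in> ?C i"
    "emb (\<lambda>i j. E (x i) (x j)) (ch p q) (ext p ?S) ?S"
    using ch_real[of p q] Q_card[of p q] unfolding realised_def by blast
  then show ?thesis using n ext_src[OF Q_M] by (intro exI[of _ x]) (auto split: if_splits)
qed

text \<open>Fewer than \<open>\<kappa> * w\<close> vertices of \<open>Y\<close> fail to be the root
  of the first tree, since otherwise \<open>child_exists\<close> would apply to them. The second
  tree is rooted at one of the remaining vertices; the two copies share that root and use disjoint
  positions otherwise.\<close>

lemma joint_exists:
  assumes C: "\<And>m. m \<in> nodes p \<Longrightarrow> C m \<subseteq> B m \<and> \<kappa> * w \<le> card (C m)"
    and Y: "Y \<subseteq> B (src p)" "2 * \<kappa> * w \<le> card Y"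
  shows "\<exists>x. joint p x \<and> x (src p) \<in> Y \<and> (\<forall>m\<in>nodes p. x m \<in> C m)"
proof -
  let ?ok = "\<lambda>q x. (\<forall>m\<in>Q p q. x m \<in> C m) \<and>
    emb (\<lambda>i j. E (x i) (x j)) (ch p q) (src p) (insert (src p) (Q p q))"
  define Y1 where "Y1 = {y \<in> Y. \<not> (\<exists>x. x (src p) = y \<and> ?ok True x)}"
  have finY: "finite Y" using Y finite_block src_I finite_subset by blast
  have "\<not> \<kappa> * w \<le> card Y1"
    using child_exists[where Y = Y1 and q = True and p = p, OF C] Y by (auto simp: Y1_def)
  moreover have "card (Y - Y1) = card Y - card Y1"
    using finY by (intro card_Diff_subset) (auto simp: Y1_def)
  ultimately have "\<kappa> * w \<le> card (Y - Y1)" using Y(2) by linarith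
  then obtain x2 where x2: "x2 (src p) \<in> Y - Y1" "?ok False x2"
    using child_exists[where Y = "Y - Y1" and q = False and p = p, OF C] Y(1) by blast
  then obtain x1 where x1: "x1 (src p) = x2 (src p)" "?ok True x1" by (auto simp: Y1_def)
  define x where "x i = (if i \<in> Q p True then x1 i else x2 i)" for i
  have n: "src p \<notin> Q p q" for q using src_notin_M Q_M by blast
  have e1: "x i = x1 i" if "i \<in> insert (src p) (Q p True)" for i
    using that x1 n by (auto simp: x_def)
  have e2: "x i = x2 i" if "i \<in> insert (src p) (Q p False)" for i
    using that n Q_disj[of p] by (auto simp: x_def)
  have "emb (\<lambda>i j. E (x i) (x j)) (ch p q) (src p) (insert (src p) (Q p q))" for q
  proof (cases q)
    case True
    have "emb (\<lambda>i j. E (x i) (x j)) (ch p True) (id (src p)) (id ` insert (src p) (Q p True))"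
      by (rule emb_map[of "\<lambda>i j. E (x1 i) (x1 j)"]) (use x1(2) e1 in auto)
    then show ?thesis using True by simp
  next
    case False
    have "emb (\<lambda>i j. E (x i) (x j)) (ch p False) (id (src p)) (id ` insert (src p) (Q p False))"
      by (rule emb_map[of "\<lambda>i j. E (x2 i) (x2 j)"]) (use x2(2) e2 in auto)
    then show ?thesis using False by simp
  qed
  moreover have xC: "\<forall>m\<in>nodes p. x m \<in> C m"
    using x1(2) x2(2) e1 e2 by (auto simp: nodes_def)
  moreover have xY: "x (src p) \<in> Y" using x2(1) e2 by simp
  ultimately show ?thesis using C Y(1) unfolding joint_def by blast
qed

section \<open>Copies whose root dominates their other vertices in the target blocks\<close>

definition target :: "'a set" where
  "target = B (tgt True) \<union> B (tgt False)"

lemma target_V: "target \<subseteq> V"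
  using block_sub tgt_I by (auto simp: target_def)

text \<open>Let \<open>d\<close> be the larger of the two medians of the degrees into \<open>W\<close> of the source blocks.
  If many vertices of a middle block had degree at least \<open>d / (4 * \<tau>)\<close>, then a greedily chosen
  subset of \<open>W\<close> would cover part of that block while missing a quarter of each source block, against
  concavity. So some copy has a root of degree at least \<open>d\<close> and all other vertices of small degree.\<close>
lemma productive_joint:
  assumes W: "W \<subseteq> target" "\<kappa> * w \<le> card W"
  shows "\<exists>p x. joint p x \<and> {u \<in> W. E u (x (src p))} \<noteq> {} \<and>
    2 * card {u \<in> W. \<exists>m\<in>nodes p. E u (x m)} \<le> card {u \<in> W. E u (x (src p))}"
proof -
  have WV: "W \<subseteq> V" using W target_V by blast
  then have finW: "finite W" using finite_V finite_subset by blast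
  define dg where "dg v = card {u \<in> W. E v u}" for v
  have dg_sym: "card {u \<in> W. E u v} = dg v" if "v \<in> V" for v
    unfolding dg_def using E_sym WV that by (metis (no_types, lifting) subset_iff)
  define low where "low d p = {y \<in> B (src p). dg y \<le> d}" for d p
  define d where "d = (LEAST d. \<forall>p. real w / 2 \<le> card (low d p))"
  have "dg v \<le> card W" for v unfolding dg_def using finW by (intro card_mono) auto
  then have "low (card W) p = B (src p)" for p by (auto simp: low_def)
  then have "\<forall>p. real w / 2 \<le> card (low (card W) p)" using block_card src_I by simp
  then have low_d: "real w / 2 \<le> card (low d p)" for p
    unfolding d_def by (rule LeastI2) auto
  have smallk: "\<kappa> * w \<le> w / 1000" by (rule kappa_w)
  have smalll: "lam * w \<le> w / 1000" by (rule lam_w)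
  have wp: "real w > 0" using w_pos by simp
  have srcV: "B (src p) \<subseteq> V" for p using block_sub src_I by blast
  have src_tgt: "B (src p) \<inter> B (tgt q) = {}" for p q
    by (rule block_disj) (use src_I tgt_I order in \<open>cases p; cases q; auto\<close>)+
  \<comment> \<open>If \<open>d\<close> were 0, half of a source block would have no neighbour in
    \<open>W\<close>, against \<open>linked\<close>.\<close>
  have d1: "d \<ge> 1"
  proof (rule ccontr)
    assume "\<not> d \<ge> 1"
    then have "d = 0" by simp
    then have "low d True = {y \<in> B (src True). \<forall>u\<in>W. \<not> E y u}"
      using finW by (auto simp: low_def dg_def)
    moreover have "\<exists>u\<in>low d True. \<exists>v\<in>W. E u v"
    proof (rule linked)
      show "\<kappa> * w \<le> card (low d True)" using low_d[of True] smallk wp by linarith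
      show "low d True \<inter> W = {}" using W(1) src_tgt by (auto simp: low_def target_def)
      show "low d True \<subseteq> V" using srcV by (auto simp: low_def)
    qed (use WV W in auto)
    ultimately show False by auto
  qed
  define high where "high p = {y \<in> B (src p). d \<le> dg y}" for p
  obtain p where "real w / 2 \<le> card (high p)"
  proof -
    \<comment> \<open>Minimality of \<open>d\<close> fails at \<open>d - 1\<close> for some side
      \<open>p\<close>, so more than half of that source block has degree at least
      \<open>d\<close>.\<close>
    have "d - 1 < d" using d1 by simp
    then obtain p where p: "card (low (d - 1) p) < real w / 2"
      using not_less_Least[of "d - 1" "\<lambda>d. \<forall>p. real w / 2 \<le> card (low d p)"]
      unfolding d_def[symmetric] by (auto simp: not_le)
    have "high p = B (src p) - low (d - 1) p" using d1 by (auto simp: high_def low_def)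
    then have "card (high p) = card (B (src p)) - card (low (d - 1) p)"
      using finite_block[OF src_I] by (simp add: low_def card_Diff_subset)
    then have "card (high p) = w - card (low (d - 1) p)" using block_card src_I by simp
    then have "real w / 2 \<le> card (high p)" using p by linarith
    then show ?thesis using that by blast
  qed
  note high = this
  define bad where "bad m = {z \<in> B m. d < 4 * \<tau> * dg z}" for m
  have bad: "card (bad m) < real w / 8" if m: "m \<in> M" for m
  proof (rule ccontr)
    assume "\<not> card (bad m) < real w / 8"
    then have big: "real w / 8 \<le> card (bad m)" by simp
    \<comment> \<open>The low-degree parts of both source blocks are treated together, so that one
      set \<open>X\<close> misses the two blocks at once.\<close>
    define L where "L = low d True \<union> low d False"
    have mI: "m \<in> I" using m M_I by blast
    obtain X where X: "X \<subseteq> W" "lam * w \<le> card {z \<in> bad m. \<exists>u\<in>X. E z u}"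
      "card {q \<in> L. \<exists>u\<in>X. E q u} \<le> real w / 4"
    proof (rule greedy_cover[of W "bad m" L d])
      show "bad m \<subseteq> V" using block_sub[OF mI] by (auto simp: bad_def)
      show "L \<subseteq> V" using srcV by (auto simp: L_def low_def)
      have "card (low d p) \<le> w" for p
        using card_mono[OF finite_block[OF src_I], of "low d p" p] block_card[OF src_I]
        by (auto simp: low_def)
      then show "card L \<le> 2 * w" unfolding L_def
        by (metis add_mono card_Un_le mult_2 order_trans)
    qed (use WV big in \<open>auto simp: bad_def dg_def L_def low_def\<close>)
    have "lam * w \<le> card {v \<in> B m. \<exists>u\<in>X. E v u}"
      using X(2) card_mono[of "{v \<in> B m. \<exists>u\<in>X. E v u}" "{z \<in> bad m. \<exists>u\<in>X. E z u}"]
        finite_block[OF mI] by (fastforce simp: bad_def)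
    then have cov: "covers E lam (bwidth I B) X (B m)" by (simp add: covers_def width)
    have mis: "misses E lam (bwidth I B) X (B (src p))" for p
    proof -
      have finlow: "finite (low d p)" using finite_block[OF src_I] by (simp add: low_def)
      have finL: "finite L" using finite_block[OF src_I] by (simp add: low_def L_def)
      let ?N = "{q \<in> L. \<exists>u\<in>X. E q u}"
      have "low d p - ?N \<subseteq> {v \<in> B (src p). \<not> (\<exists>u\<in>X. E v u)}"
        by (cases p) (auto simp: low_def L_def)
      then have "card (low d p - ?N) \<le> card {v \<in> B (src p). \<not> (\<exists>u\<in>X. E v u)}"
        using finite_block[OF src_I] by (intro card_mono) auto
      moreover have "card (low d p) - card ?N \<le> card (low d p - ?N)"
        using finL by (intro diff_card_le_card_Diff) auto
      ultimately show ?thesis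
        using X(3) low_d[of p] smalll wp unfolding misses_def width by linarith
    qed
    have "X \<subseteq> bverts I B - (B (src True) \<union> B m \<union> B (src False))"
    proof -
      have "B m \<inter> B (tgt q) = {}" for q
        by (rule block_disj) (use mI tgt_I tgt_ends[of m] m in \<open>cases q; auto\<close>)+
      moreover have "X \<subseteq> B (tgt True) \<union> B (tgt False)" using X(1) W(1) by (auto simp: target_def)
      moreover have "B (tgt q) \<subseteq> bverts I B" for q using tgt_I by (auto simp: bverts_def)
      ultimately show ?thesis using src_tgt by blast
    qed
    then show False
      using conc cov mis order(4)[OF m] src_I mI unfolding concave_def by blast
  qed
  obtain x where x: "joint p x" "x (src p) \<in> high p" "\<forall>m\<in>nodes p. x m \<in> B m - bad m"
  proof -
    have "\<exists>x. joint p x \<and> x (src p) \<in> high p \<and> (\<forall>m\<in>nodes p. x m \<in> B m - bad m)"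
    proof (rule joint_exists)
      fix m assume "m \<in> nodes p"
      then have m: "m \<in> M" "m \<in> I" using nodes_M M_I by blast+
      have "card (B m - bad m) = w - card (bad m)"
        using finite_block[OF m(2)] block_card[OF m(2)] by (simp add: bad_def card_Diff_subset)
      then have "\<kappa> * w \<le> card (B m - bad m)"
        using bad[OF m(1)] smallk wp by linarith
      then show "B m - bad m \<subseteq> B m \<and> \<kappa> * w \<le> card (B m - bad m)" by blast
    next
      show "2 * \<kappa> * w \<le> card (high p)" using high smallk wp by linarith
    qed (auto simp: high_def)
    then show ?thesis using that by blast
  qed
  have xV: "x i \<in> V" if "i \<in> insert (src p) (nodes p)" for i
    using x(1) that block_sub src_I nodes_M M_I unfolding joint_def by blast
  have finn: "finite (nodes p)" using nodes_M finite_M finite_subset by blast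
  have "card {u \<in> W. \<exists>m\<in>nodes p. E u (x m)} \<le> (\<Sum>m\<in>nodes p. card {u \<in> W. E u (x m)})"
  proof -
    have "{u \<in> W. \<exists>m\<in>nodes p. E u (x m)} = (\<Union>m\<in>nodes p. {u \<in> W. E u (x m)})" by auto
    then show ?thesis using card_UN_le[OF finn] by metis
  qed
  also have "\<dots> = (\<Sum>m\<in>nodes p. dg (x m))" using xV dg_sym by (intro sum.cong) auto
  \<comment> \<open>There are at most 2\<tau> vertices besides the root, each of degree at most
    d/(4\<tau>), so jointly they see at most d/2 vertices of \<open>W\<close>.\<close>
  finally have "4 * \<tau> * card {u \<in> W. \<exists>m\<in>nodes p. E u (x m)} \<le> 4 * \<tau> * (\<Sum>m\<in>nodes p. dg (x m))"
    by (rule mult_le_mono2)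
  also have "\<dots> = (\<Sum>m\<in>nodes p. 4 * \<tau> * dg (x m))" by (rule sum_distrib_left)
  also have "\<dots> \<le> card (nodes p) * d"
    using sum_bounded_above[of "nodes p" "\<lambda>m. 4 * \<tau> * dg (x m)" d] x(3)
    by (auto simp: bad_def not_less)
  also have "\<dots> \<le> 2 * \<tau> * d" using card_nodes by (intro mult_right_mono) auto
  finally have "2 * card {u \<in> W. \<exists>m\<in>nodes p. E u (x m)} \<le> d"
    using tau by simp
  moreover have "d \<le> card {u \<in> W. E u (x (src p))}"
    using x(2) dg_sym[of "x (src p)"] xV by (simp add: high_def)
  ultimately have "2 * card {u \<in> W. \<exists>m\<in>nodes p. E u (x m)} \<le> card {u \<in> W. E u (x (src p))}"
    "1 \<le> card {u \<in> W. E u (x (src p))}"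
    using d1 by linarith+
  moreover from this(2) have "{u \<in> W. E u (x (src p))} \<noteq> {}" by fastforce
  ultimately show ?thesis using x(1) by blast
qed

section \<open>Covering half of a target block by copies\<close>

definition cov :: "(bool \<times> (int \<Rightarrow> 'a)) set \<Rightarrow> 'a set" where
  "cov F = {v \<in> target. \<exists>p x. (p, x) \<in> F \<and> (\<exists>m\<in>insert (src p) (nodes p). E v (x m))}"

text \<open>Privacy refers to one copy: the vertex sees the root of that copy and nothing else of
  it, but it may well see other copies in \<open>F\<close>.\<close>

definition priv :: "(bool \<times> (int \<Rightarrow> 'a)) set \<Rightarrow> bool \<Rightarrow> bool \<Rightarrow> 'a set" where
  "priv F p q = {v \<in> B (tgt q). \<exists>x. (p, x) \<in> F \<and> E v (x (src p)) \<and> (\<forall>m\<in>nodes p. \<not> E v (x m))}"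

text \<open>Concavity is applied to these sets, one position at a time, because each of them lies in
  a single block.\<close>

definition pos :: "(bool \<times> (int \<Rightarrow> 'a)) set \<Rightarrow> int \<Rightarrow> 'a set" where
  "pos F m = {x m | p x. (p, x) \<in> F \<and> m \<in> insert (src p) (nodes p)}"

lemma finite_target: "finite target"
  using target_V finite_V finite_subset by blast

lemma finite_cov: "finite (cov F)"
  using finite_target by (simp add: cov_def)

lemma block_target: "B (tgt q) \<subseteq> target"
  by (cases q) (simp_all add: target_def)

lemma covI: "v \<in> target \<Longrightarrow> (p, x) \<in> F \<Longrightarrow> m \<in> insert (src p) (nodes p) \<Longrightarrow> E v (x m) \<Longrightarrow> v \<in> cov F"
  unfolding cov_def by (intro CollectI conjI exI bexI)

lemma priv_cov: "priv F p q \<subseteq> cov F"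
proof
  fix v assume "v \<in> priv F p q"
  then obtain x where v: "v \<in> B (tgt q)" "(p, x) \<in> F" "E v (x (src p))"
    unfolding priv_def mem_Collect_eq by (elim exE conjE)
  show "v \<in> cov F"
    by (rule covI[OF subsetD[OF block_target v(1)] v(2) insertI1 v(3)])
qed

lemma finite_priv: "finite (priv F p q)"
  by (rule finite_subset[OF priv_cov finite_cov])

text \<open>Productive copies are added one at a time until half of a target block is covered; each step
  covers at least a third of the new vertices privately. The term \<open>\<kappa> * w\<close> accounts for the single
  vertex by which the last step extends a position.\<close>
lemma growth:
  "\<exists>F q. (\<forall>(p, x)\<in>F. joint p x) \<and> card (cov F) \<le> 3 * card (\<Union>p q. priv F p q) \<and>
    real w / 2 < card (cov F \<inter> B (tgt q)) \<and>
    (\<forall>m q. card {v \<in> B (tgt q). \<exists>u\<in>pos F m. E v u} \<le> real w / 2 + \<kappa> * w)"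
proof -
  define good where "good F \<longleftrightarrow> (\<forall>(p, x)\<in>F. joint p x) \<and> card (cov F) \<le> 3 * card (\<Union>p q. priv F p q) \<and>
    (\<forall>q. card (cov F \<inter> B (tgt q)) \<le> real w / 2)" for F
  have "good {}" by (simp add: good_def cov_def)
  moreover have "card (cov F) < Suc (card target)" for F
    using card_mono[OF finite_target, of "cov F"] by (simp add: cov_def less_Suc_eq_le)
  \<comment> \<open>In a good family of greatest coverage, a further productive copy increases the
    coverage and preserves the first two conditions, so the third one must break.\<close>
  ultimately have "\<exists>F. good F \<and> (\<forall>G. good G \<longrightarrow> card (cov G) \<le> card (cov F))"
    by (intro ex_has_greatest_nat[of good "{}" "\<lambda>F. card (cov F)" "Suc (card target)"]) blast+
  then obtain F where F: "good F" and maxF: "\<And>G. good G \<Longrightarrow> card (cov G) \<le> card (cov F)"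
    by blast
  define W where "W = target - cov F"
  have finW: "finite W" using finite_target by (simp add: W_def)
  have "B (tgt True) - cov F \<inter> B (tgt True) \<subseteq> W" by (auto simp: W_def target_def)
  then have "card (B (tgt True) - cov F \<inter> B (tgt True)) \<le> card W" using finW by (intro card_mono)
  moreover have "card (B (tgt True) - cov F \<inter> B (tgt True)) = w - card (cov F \<inter> B (tgt True))"
    using card_Diff_subset[of "cov F \<inter> B (tgt True)" "B (tgt True)"] finite_cov block_card[OF tgt_I]
    by simp
  moreover have "card (cov F \<inter> B (tgt True)) \<le> real w / 2" using F by (simp add: good_def)
  ultimately have "real w / 2 \<le> card W" by linarith
  then have "\<kappa> * w \<le> card W" using kappa_w w_pos by linarith
  moreover have "W \<subseteq> target" by (simp add: W_def)
  ultimately have "\<exists>p x. joint p x \<and> {u \<in> W. E u (x (src p))} \<noteq> {} \<and>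
      2 * card {u \<in> W. \<exists>m\<in>nodes p. E u (x m)} \<le> card {u \<in> W. E u (x (src p))}"
    by (intro productive_joint)
  then obtain p x where px: "joint p x" "{u \<in> W. E u (x (src p))} \<noteq> {}"
    "2 * card {u \<in> W. \<exists>m\<in>nodes p. E u (x m)} \<le> card {u \<in> W. E u (x (src p))}"
    by (elim exE conjE)
  define G where "G = insert (p, x) F"
  let ?Y = "{u \<in> W. E u (x (src p))}"
  let ?Z = "{u \<in> W. \<exists>m\<in>nodes p. E u (x m)}"
  have finYZ: "finite ?Y" "finite ?Z" using finW by auto
  have "cov G = cov F \<union> {u \<in> target. \<exists>m\<in>insert (src p) (nodes p). E u (x m)}"
    unfolding cov_def G_def by blast
  also have "\<dots> = cov F \<union> {u \<in> W. \<exists>m\<in>insert (src p) (nodes p). E u (x m)}"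
    unfolding W_def by blast
  also have "\<dots> = cov F \<union> (?Y \<union> ?Z)" by blast
  finally have "cov G = cov F \<union> (?Y \<union> ?Z)" .
  moreover have "cov F \<inter> (?Y \<union> ?Z) = {}" by (auto simp: W_def)
  ultimately have cG: "card (cov G) = card (cov F) + card (?Y \<union> ?Z)"
    using finite_cov finYZ by (simp add: card_Un_disjoint)
  have "card ?Y > 0" using px(2) finYZ by (simp add: card_gt_0_iff)
  moreover have "card ?Y \<le> card (?Y \<union> ?Z)" using finYZ by (intro card_mono) auto
  ultimately have gt: "card (cov F) < card (cov G)" using cG by linarith
  let ?P = "\<lambda>F. \<Union>p q. priv F p q"
  have finP: "finite (?P F)" for F using finite_priv by auto
  \<comment> \<open>Since \<open>2 * card ?Z \<le> card ?Y\<close>, at least half of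
    \<open>?Y\<close> becomes private while at most 3/2 times its size is newly covered. This is the
    source of the factor 3.\<close>
  have "?P F \<union> (?Y - ?Z) \<subseteq> ?P G"
  proof -
    have "priv F p' q \<subseteq> priv G p' q" for p' q by (auto simp: priv_def G_def)
    then have "?P F \<subseteq> ?P G" by (intro UN_mono order_refl)
    moreover have "?Y - ?Z \<subseteq> ?P G"
    proof
      fix v assume v: "v \<in> ?Y - ?Z"
      have "v \<in> target" using v by (simp add: W_def)
      then obtain q where "v \<in> B (tgt q)" by (auto simp: target_def)
      then have "v \<in> priv G p q" using v by (auto simp: priv_def G_def)
      then show "v \<in> ?P G" by (intro UN_I[of p] UN_I[of q]) simp_all
    qed
    ultimately show ?thesis by (rule Un_least)
  qed
  then have "card (?P F \<union> (?Y - ?Z)) \<le> card (?P G)" using finP by (intro card_mono)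
  moreover have "?P F \<subseteq> cov F" using priv_cov by (intro UN_least)
  then have "?P F \<inter> (?Y - ?Z) = {}" by (auto simp: W_def)
  then have "card (?P F \<union> (?Y - ?Z)) = card (?P F) + card (?Y - ?Z)"
    using finP finYZ by (intro card_Un_disjoint) auto
  moreover have "card ?Y - card ?Z \<le> card (?Y - ?Z)"
    using finYZ by (intro diff_card_le_card_Diff) auto
  moreover have "card (?Y \<union> ?Z) \<le> card ?Y + card ?Z" by (rule card_Un_le)
  moreover have "card (cov F) \<le> 3 * card (?P F)" using F by (simp add: good_def)
  ultimately have G3: "card (cov G) \<le> 3 * card (?P G)" using px(3) cG by linarith
  have jG: "\<forall>(p, x)\<in>G. joint p x" using F px(1) by (auto simp: good_def G_def)
  have "\<not> good G" using maxF[of G] gt by linarith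
  then have "\<not> (\<forall>q. card (cov G \<inter> B (tgt q)) \<le> real w / 2)"
    using jG G3 unfolding good_def by blast
  then obtain q where q: "real w / 2 < card (cov G \<inter> B (tgt q))"
    by (metis not_le)
  have "card {v \<in> B (tgt q). \<exists>u\<in>pos G m. E v u} \<le> real w / 2 + \<kappa> * w" for m q
  proof -
    let ?N = "if m \<in> insert (src p) (nodes p) then {v \<in> V. E (x m) v} else {}"
    have mV: "x m \<in> V" if "m \<in> insert (src p) (nodes p)"
      using px(1) that block_sub src_I nodes_M M_I unfolding joint_def by blast
    have tV: "B (tgt q) \<subseteq> V" using block_sub tgt_I by blast
    have pG: "pos G m = pos F m \<union> (if m \<in> insert (src p) (nodes p) then {x m} else {})"
      by (auto simp: pos_def G_def)
    have pF: "v \<in> cov F" if v: "v \<in> B (tgt q)" and u: "u \<in> pos F m" "E v u" for u v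
    proof -
      obtain p' x' where "(p', x') \<in> F" "m \<in> insert (src p') (nodes p')" "u = x' m"
        using u(1) by (auto simp: pos_def)
      then show ?thesis using covI[of v p' x' F m] subsetD[OF block_target v] u(2) by simp
    qed
    have "{v \<in> B (tgt q). \<exists>u\<in>pos G m. E v u} \<subseteq> cov F \<inter> B (tgt q) \<union> ?N"
    proof
      fix v assume "v \<in> {v \<in> B (tgt q). \<exists>u\<in>pos G m. E v u}"
      then obtain u where v: "v \<in> B (tgt q)" and u: "u \<in> pos G m" "E v u" by blast
      show "v \<in> cov F \<inter> B (tgt q) \<union> ?N"
      proof (cases "u \<in> pos F m")
        case True
        then show ?thesis using pF v u by blast
      next
        case False
        then have "m \<in> insert (src p) (nodes p)" "u = x m" using u(1) pG by (auto split: if_splits)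
        then show ?thesis using mV v tV u(2) E_sym by auto
      qed
    qed
    then have "card {v \<in> B (tgt q). \<exists>u\<in>pos G m. E v u} \<le> card (cov F \<inter> B (tgt q) \<union> ?N)"
      using finite_cov finite_V by (intro card_mono) auto
    also have "\<dots> \<le> card (cov F \<inter> B (tgt q)) + card ?N" by (rule card_Un_le)
    finally have "card {v \<in> B (tgt q). \<exists>u\<in>pos G m. E v u} \<le> card (cov F \<inter> B (tgt q)) + card ?N" .
    moreover have "card (cov F \<inter> B (tgt q)) \<le> real w / 2" using F by (simp add: good_def)
    moreover have "card ?N \<le> \<kappa> * w"
    proof (cases "m \<in> insert (src p) (nodes p)")
      case True
      then show ?thesis using deg_small[OF mV] by simp
    next
      case False
      then show ?thesis using kappa by auto
    qed
    ultimately show ?thesis by linarith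
  qed
  then show ?thesis using jG G3 q by (intro exI[of _ G] exI[of _ q]) simp
qed

text \<open>The tree \<open>rt p q\<close> is rooted at a private vertex of \<open>tgt q\<close>,
  and its other vertices are chosen among those seeing no relevant vertex of any copy in
  \<open>F\<close>. Privacy then supplies a copy of \<open>ch p q\<close> joined to it by the edge
  between the roots and by no other.\<close>

lemma merge:
  assumes Q'_M: "\<And>p q. Q' p q \<subseteq> M" and Q'_disj: "\<And>p q. Q p q \<inter> Q' p q = {}"
    and Q'_card: "\<And>p q. card (insert (tgt q) (Q' p q)) = tsize (rt p q)"
    and rt_real: "\<And>p q. realised q (rt p q)"
    and size: "\<And>p q. tsize (ch p q) + tsize (rt p q) \<le> \<tau>"
  shows "\<exists>p q. realised q (attach (rt p q) (ch p q)) \<and>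
    (p \<noteq> q \<longrightarrow> realised p (attach (ch p q) (rt p q)))"
proof -
  obtain F q0 where jF': "\<forall>(p, x)\<in>F. joint p x"
    and F3: "card (cov F) \<le> 3 * card (\<Union>p q. priv F p q)"
    and half: "real w / 2 < card (cov F \<inter> B (tgt q0))"
    and F_pos': "\<forall>m q. card {v \<in> B (tgt q). \<exists>u\<in>pos F m. E v u} \<le> real w / 2 + \<kappa> * w"
    using growth by (elim exE conjE)
  have jF: "joint p x" if "(p, x) \<in> F" for p x using jF' that by blast
  note F_pos = F_pos'[rule_format]
  have "card (cov F \<inter> B (tgt q0)) \<le> card (cov F)" using finite_cov by (intro card_mono) auto
  \<comment> \<open>More than half a block is covered, so more than w/6 vertices are private; one of
    the four pairs of sides receives more than w/24, well above \<open>\<kappa> * w\<close>.\<close>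
  then have sixth: "real w / 6 < card (\<Union>p q. priv F p q)" using half F3 by linarith
  have "(\<Union>p q. priv F p q) = (priv F True True \<union> priv F True False) \<union> (priv F False True \<union> priv F False False)"
    by (simp add: UNIV_bool Un_ac)
  then have "card (\<Union>p q. priv F p q) = card ((priv F True True \<union> priv F True False) \<union> (priv F False True \<union> priv F False False))"
    by (rule arg_cong)
  then have "card (\<Union>p q. priv F p q) \<le>
      (card (priv F True True) + card (priv F True False)) + (card (priv F False True) + card (priv F False False))"
    using card_Un_le[of "priv F True True \<union> priv F True False" "priv F False True \<union> priv F False False"]
      card_Un_le[of "priv F True True" "priv F True False"]
      card_Un_le[of "priv F False True" "priv F False False"] by linarith
  then have "\<not> (\<forall>p q. card (priv F p q) \<le> real w / 24)"
  proof (intro notI)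
    assume "\<forall>p q. card (priv F p q) \<le> real w / 24"
    then have "card (priv F True True) \<le> real w / 24" "card (priv F True False) \<le> real w / 24"
      "card (priv F False True) \<le> real w / 24" "card (priv F False False) \<le> real w / 24" by simp_all
    moreover assume "card (\<Union>p q. priv F p q) \<le> (card (priv F True True) + card (priv F True False)) +
      (card (priv F False True) + card (priv F False False))"
    ultimately show False using sixth by linarith
  qed
  then obtain p q where pq: "real w / 24 < card (priv F p q)" by (auto simp: not_le)
  define K where "K = insert (src p) (Q p q)"
  define K' where "K' = insert (tgt q) (Q' p q)"
  have Qn: "Q p q \<subseteq> nodes p" by (cases q) (auto simp: nodes_def)
  have KI: "K \<subseteq> I" using src_I Q_M M_I unfolding K_def by blast
  have K'I: "K' \<subseteq> I" using tgt_I Q'_M M_I unfolding K'_def by blast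
  have t_notin: "tgt q \<notin> insert (src p) M" using tgt_ends[of "tgt q" p] by (cases q) auto
  have KK': "K \<inter> K' = {}"
    using Q_M[of p q] Q'_M[of p q] Q'_disj[of p q] src_notin_M[of p] t_notin by (auto simp: K_def K'_def)
  have posB: "pos F i \<subseteq> B i" if "i \<in> I" for i
    using jF unfolding pos_def joint_def by blast
  \<comment> \<open>Each position covers at most w/2 + \<open>\<kappa> * w\<close> of either target
    block and therefore misses both. The block \<open>m\<close> lies between them, so concavity
    forbids covering it.\<close>
  have few: "card {v \<in> B m. \<exists>u\<in>pos F i. E v u} \<le> lam * w" if i: "i \<in> K" and m: "m \<in> Q' p q" for i m
  proof -
    have iM: "i \<in> insert (src p) M" using i Q_M[of p q] by (auto simp: K_def)
    then have iI: "i \<in> I" using i KI by blast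
    have mM: "m \<in> M" and mI: "m \<in> I" using m Q'_M M_I by blast+
    have "i \<noteq> m" using KK' i m by (auto simp: K'_def)
    have "misses E lam (bwidth I B) (pos F i) (B (tgt q))" for q
    proof -
      let ?A = "{v \<in> B (tgt q). \<exists>u\<in>pos F i. E v u}"
      have "{v \<in> B (tgt q). \<not> (\<exists>u\<in>pos F i. E v u)} = B (tgt q) - ?A" by blast
      then have "card {v \<in> B (tgt q). \<not> (\<exists>u\<in>pos F i. E v u)} = w - card ?A"
        using finite_block[OF tgt_I] block_card[OF tgt_I] by (simp add: card_Diff_subset)
      then show ?thesis
        using F_pos[of q i] kappa_w lam_w w_pos unfolding misses_def width by linarith
    qed
    moreover have "pos F i \<subseteq> bverts I B - (B (tgt True) \<union> B m \<union> B (tgt False))"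
    proof -
      have "B i \<inter> B m = {}" using block_disj iI mI \<open>i \<noteq> m\<close> by blast
      moreover have "i \<noteq> tgt q" for q using tgt_ends[OF iM] by (cases q) auto
      then have "B i \<inter> B (tgt q) = {}" for q using block_disj iI tgt_I by blast
      ultimately show ?thesis using posB[OF iI] iI by (auto simp: bverts_def)
    qed
    ultimately have "\<not> covers E lam (bwidth I B) (pos F i) (B m)"
      using conc tgt_I mI tgt_ends[of m p] mM unfolding concave_def by blast
    then show ?thesis by (simp add: covers_def width)
  qed
  have finK: "finite K" using KI finite_I finite_subset by blast
  have cK: "card K \<le> \<tau>" using Q_card[of p q] ch_size[of p q] by (simp add: K_def)
  \<comment> \<open>The whole of \<open>F\<close> at the positions in \<open>K\<close> is avoided,
    because the copy to be joined is known only once the new root has been found.\<close>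
  define C where "C m = (if m = tgt q then priv F p q
     else {v \<in> B m. \<not> (\<exists>i\<in>K. \<exists>u\<in>pos F i. E v u)})" for m
  have C: "C m \<subseteq> B m \<and> \<kappa> * w \<le> card (C m)" if m: "m \<in> K'" for m
  proof (cases "m = tgt q")
    case True
    then show ?thesis using pq kappa_w by (auto simp: C_def priv_def)
  next
    case False
    then have mQ: "m \<in> Q' p q" using m by (simp add: K'_def)
    have mI: "m \<in> I" using m K'I by blast
    let ?A = "\<lambda>i. {v \<in> B m. \<exists>u\<in>pos F i. E v u}"
    have "C m = B m - (\<Union>i\<in>K. ?A i)" using False by (auto simp: C_def)
    moreover have "(\<Union>i\<in>K. ?A i) \<subseteq> B m" by blast
    ultimately have "card (C m) = w - card (\<Union>i\<in>K. ?A i)"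
      using card_block_Diff[OF mI] by simp
    moreover have "real (card (\<Union>i\<in>K. ?A i)) \<le> \<kappa> * w"
    proof -
      have "real (card (\<Union>i\<in>K. ?A i)) \<le> (\<Sum>i\<in>K. real (card (?A i)))"
        using card_UN_le[OF finK, of ?A] by (simp only: of_nat_sum[symmetric] of_nat_le_iff)
      also have "\<dots> \<le> card K * (lam * w)"
        using few mQ by (intro sum_bounded_above) auto
      also have "\<dots> \<le> \<tau> * (lam * w)" using cK lam by (intro mult_right_mono) auto
      also have "\<dots> = (lam * \<tau>) * w" by simp
      also have "\<dots> \<le> \<kappa> * w" using lam by (intro mult_right_mono) auto
      finally show ?thesis .
    qed
    ultimately have "\<kappa> * w \<le> card (C m)" using kappa_w w_pos by linarith
    then show ?thesis using False by (auto simp: C_def)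
  qed
  have extK': "ext q (K' \<union> S) = tgt q" if "S \<subseteq> insert (src p) M" for S
  proof -
    have "finite (Q' p q)" "finite S"
      using Q'_M[of p q] that finite_M finite_subset by blast+
    moreover have "\<forall>i\<in>Q' p q \<union> S. tgt True < i \<and> i < tgt False"
      using tgt_ends Q'_M[of p q] that by blast
    ultimately show ?thesis
      unfolding ext_def K'_def
      by (cases q) (auto intro!: Min_eqI Max_eqI simp: less_imp_le)
  qed
  have "ext q K' = tgt q" using extK'[of "{}"] by simp
  then obtain y where y: "\<forall>i\<in>K'. y i \<in> C i" "emb (\<lambda>i j. E (y i) (y j)) (rt p q) (tgt q) K'"
    using rt_real[of q p] K'I Q'_card[of q p] C unfolding realised_def K'_def by metis
  have "y (tgt q) \<in> priv F p q" using y(1) by (auto simp: C_def K'_def)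
  then obtain x where x: "(p, x) \<in> F" "E (y (tgt q)) (x (src p))" "\<forall>m\<in>nodes p. \<not> E (y (tgt q)) (x m)"
    by (auto simp: priv_def)
  have jx: "joint p x" using jF x(1) by blast
  have xB: "x i \<in> B i" if "i \<in> K" for i using jx that Qn by (auto simp: joint_def K_def)
  have yB: "y i \<in> B i" if "i \<in> K'" for i using y(1) C that by blast
  have embx: "emb (\<lambda>i j. E (x i) (x j)) (ch p q) (src p) K"
    using jx by (simp add: joint_def K_def)
  have only: "i = tgt q \<and> j = src p" if "i \<in> K'" "j \<in> K" "E (y i) (x j)" for i j
  proof (cases "i = tgt q")
    case True
    then show ?thesis using x(3) that Qn by (auto simp: K_def)
  next
    case False
    have "x j \<in> pos F j" using x(1) that(2) Qn by (auto simp: pos_def K_def)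
    then show ?thesis using y(1) that False by (auto simp: C_def)
  qed
  have K'K: "K' \<inter> K = {}" using KK' by blast
  note merged = merged_emb[OF K'I KI K'K yB xB y(2) embx x(2) only]
  define z where "z i = (if i \<in> K' then y i else x i)" for i
  have zB: "z i \<in> B i" if "i \<in> K' \<union> K" for i using that xB yB by (auto simp: z_def)
  have "card (K' \<union> K) = tsize (rt p q) + tsize (ch p q)"
    using emb_card[OF y(2)] emb_card[OF embx] emb_finite[OF y(2)] finK K'K by (simp add: card_Un_disjoint)
  then have c\<tau>: "card (K' \<union> K) \<le> \<tau>" using size[of p q] by simp
  have UI: "K' \<union> K \<subseteq> I" using KI K'I by blast
  have "realised q (attach (rt p q) (ch p q))"
  proof (rule realisedI[OF UI c\<tau> zB])
    have "K \<subseteq> insert (src p) M" using Q_M[of p q] by (auto simp: K_def)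
    then show "emb (\<lambda>i j. E (z i) (z j)) (attach (rt p q) (ch p q)) (ext q (K' \<union> K)) (K' \<union> K)"
      using merged(1) extK' by (simp add: z_def)
  qed
  \<comment> \<open>With \<open>p \<noteq> q\<close> the block \<open>tgt q\<close> lies at the
    opposite end, so nothing in the support lies beyond \<open>src p\<close> on side
    \<open>p\<close>.\<close>
  moreover have "realised p (attach (ch p q) (rt p q))" if "p \<noteq> q"
  proof -
    have fin: "finite (K' \<union> K)" using UI finite_I finite_subset by blast
    have "ext p (K' \<union> K) = src p"
    proof (cases p)
      case True
      then have "\<not> q" using that by simp
      then have "\<forall>i\<in>K' \<union> K. src True \<le> i"
        using True Q_M[of p q] Q'_M[of p q] order
        unfolding K_def K'_def by (auto simp: less_imp_le subset_iff)
      then show ?thesis using True fin unfolding ext_def K_def by (auto intro!: Min_eqI)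
    next
      case False
      then have q using that by simp
      then have "\<forall>i\<in>K' \<union> K. i \<le> src False"
        using False Q_M[of p q] Q'_M[of p q] order
        unfolding K_def K'_def by (auto simp: less_imp_le subset_iff)
      then show ?thesis using False fin unfolding ext_def K_def by (auto intro!: Max_eqI)
    qed
    then have "emb (\<lambda>i j. E (z i) (z j)) (attach (ch p q) (rt p q)) (ext p (K' \<union> K)) (K' \<union> K)"
      using merged(2) by (simp add: z_def)
    then show ?thesis by (intro realisedI[OF UI c\<tau> zB])
  qed
  ultimately show ?thesis by blast
qed

end

section \<open>The trichotomy and the construction of T(\<delta>, \<eta>)\<close>

context uniform_blockade
begin

text \<open>Four blocks serve as ends. The middle splits into three disjoint parts of at least
  \<open>\<tau>\<close> blocks each: \<open>N0\<close> and \<open>N1\<close> hold the two trees of a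
  joint copy, and the rest holds the tree rooted in a target block.\<close>

lemma some_merge:
  assumes I: "3 * \<tau> + 4 \<le> card I"
    and ch_real: "\<And>p q. realised p (ch p q)" and rt_real: "\<And>p q. realised q (rt p q)"
    and size: "\<And>p q. tsize (ch p q) + tsize (rt p q) \<le> \<tau>"
  shows "\<exists>p q. realised q (attach (rt p q) (ch p q)) \<and>
    (p \<noteq> q \<longrightarrow> realised p (attach (ch p q) (rt p q)))"
proof -
  define L1 where "L1 = Min I"
  define R1 where "R1 = Max I"
  define I' where "I' = I - {L1, R1}"
  define L2 where "L2 = Min I'"
  define R2 where "R2 = Max I'"
  define M where "M = I' - {L2, R2}"
  have card_minus2: "card A \<le> card (A - {a, b}) + 2" for A :: "int set" and a b
    using diff_card_le_card_Diff[of "{a, b}" A] card_insert_le_m1[of 2 "{b}" a]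
    by (auto simp: card_insert_if split: if_splits)
  have cI': "3 * \<tau> + 2 \<le> card I'" using card_minus2[of I L1 R1] I by (simp add: I'_def)
  have cM: "3 * \<tau> \<le> card M" using card_minus2[of I' L2 R2] cI' by (simp add: M_def)
  have fin: "finite I'" "finite M" using finite_I by (auto simp: I'_def M_def)
  have ne: "I \<noteq> {}" "I' \<noteq> {}" "M \<noteq> {}" using I cI' cM tau by auto
  have I'I: "L1 < i \<and> i < R1" if "i \<in> I'" for i
    using that finite_I unfolding I'_def L1_def R1_def by (auto simp: less_le)
  have MI': "L2 < m \<and> m < R2" if "m \<in> M" for m
    using that fin(1) unfolding M_def L2_def R2_def by (auto simp: less_le)
  have mem: "L1 \<in> I" "R1 \<in> I" "L2 \<in> I'" "R2 \<in> I'"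
    using finite_I fin ne by (simp_all add: L1_def R1_def L2_def R2_def)
  have sub: "I' \<subseteq> I" "M \<subseteq> I'" by (auto simp: I'_def M_def)
  obtain N0 where N0: "N0 \<subseteq> M" "card N0 = \<tau>" "finite N0"
    using obtain_subset_with_card_n[of \<tau> M] cM by (metis le_add1 mult_2 mult_Suc numeral_3_eq_3 numeral_2_eq_2 order_trans)
  have c1: "2 * \<tau> \<le> card (M - N0)" using cM N0 by (simp add: card_Diff_subset)
  obtain N1 where N1: "N1 \<subseteq> M - N0" "card N1 = \<tau>" "finite N1"
    using obtain_subset_with_card_n[of \<tau> "M - N0"] c1 by auto
  have c2: "\<tau> \<le> card (M - N0 - N1)" using c1 N1 by (simp add: card_Diff_subset)
  define pick where "pick A k = (SOME S. S \<subseteq> A \<and> card S = k \<and> finite S)" for A :: "int set" and k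
  have pick: "pick A k \<subseteq> A \<and> card (pick A k) = k \<and> finite (pick A k)" if "k \<le> card A" for A k
    unfolding pick_def by (rule someI_ex) (use obtain_subset_with_card_n[OF that] in metis)
  define N where "N q = (if q then N0 else N1)" for q
  define Q where "Q p q = pick (N q) (tsize (ch p q) - 1)" for p q
  define Q' where "Q' p q = pick (M - N0 - N1) (tsize (rt p q) - 1)" for p q
  have pos: "tsize t \<ge> 1" for t by (cases t) simp
  have "card (N q) = \<tau>" for q using N0 N1 by (simp add: N_def)
  then have "tsize (ch p q) - 1 \<le> card (N q)" for p q using size[of p q] by simp
  then have Q: "Q p q \<subseteq> N q" "card (Q p q) = tsize (ch p q) - 1" "finite (Q p q)" for p q
    unfolding Q_def using pick by blast+
  have "tsize (rt p q) - 1 \<le> card (M - N0 - N1)" for p q using size[of p q] c2 by linarith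
  then have Q': "Q' p q \<subseteq> M - N0 - N1" "card (Q' p q) = tsize (rt p q) - 1" "finite (Q' p q)" for p q
    unfolding Q'_def using pick by blast+
  have NM: "N q \<subseteq> M" for q using N0 N1 by (auto simp: N_def)
  define src where "src p = (if p then L2 else R2)" for p
  define tgt where "tgt p = (if p then L1 else R1)" for p
  have src_M: "src p \<notin> M" for p by (auto simp: src_def M_def)
  have tgt_M: "tgt p \<notin> M" for p by (auto simp: tgt_def M_def I'_def)
  interpret frame V E I B w \<tau> \<kappa> lam src tgt M ch Q
  proof
    show "tgt q \<in> I" for q using mem by (simp add: tgt_def)
    show "src p \<in> I" for p using mem sub by (auto simp: src_def)
    show "M \<subseteq> I" using sub by blast
    show "tgt True < src True" "src False < tgt False"
      using I'I mem by (auto simp: src_def tgt_def)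
    show M: "src True < m \<and> m < src False" if "m \<in> M" for m using MI'[OF that] by (simp add: src_def)
    then show "src True < src False" using ne(3) by fastforce
    show "Q p q \<subseteq> M" for p q using Q(1) NM by blast
    show "Q p True \<inter> Q p False = {}" for p
      using Q(1)[of p True] Q(1)[of p False] N1(1) by (auto simp: N_def)
    show "card (insert (src p) (Q p q)) = tsize (ch p q)" for p q
    proof -
      have "src p \<notin> Q p q" using Q(1)[of p q] NM[of q] src_M[of p] by blast
      then show ?thesis using Q(2,3)[of p q] pos[of "ch p q"] by simp
    qed
    show "tsize (ch p q) \<le> \<tau>" for p q using size[of p q] by linarith
    show "realised p (ch p q)" for p q by (rule ch_real)
  qed
  show ?thesis
  proof (rule merge[where Q' = Q'])
    show "Q' p q \<subseteq> M" for p q using Q'(1) by blast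
    show "Q p q \<inter> Q' p q = {}" for p q
      using Q(1)[of p q] Q'(1)[of p q] by (auto simp: N_def split: if_splits)
    show "card (insert (tgt q) (Q' p q)) = tsize (rt p q)" for p q
    proof -
      have "tgt q \<notin> Q' p q" using Q'(1)[of p q] tgt_M[of q] by blast
      then show ?thesis using Q'(2,3)[of p q] pos[of "rt p q"] by simp
    qed
  qed (use rt_real size in auto)
qed

definition mergeable :: "bool \<Rightarrow> bool \<Rightarrow> bool" where
  "mergeable p q \<longleftrightarrow> (\<forall>t s. realised p t \<longrightarrow> realised q s \<longrightarrow> tsize t + tsize s \<le> \<tau> \<longrightarrow>
     realised p (attach t s))"

text \<open>Counterexamples to the three kinds of merging are put on the same four end blocks.\<close>
lemma trichotomy:
  assumes "3 * \<tau> + 4 \<le> card I"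
  shows "mergeable True True \<or> mergeable False False \<or> (mergeable True False \<and> mergeable False True)"
proof (rule ccontr)
  assume neg: "\<not> ?thesis"
  obtain t1 s1 where 1: "realised True t1" "realised True s1" "tsize t1 + tsize s1 \<le> \<tau>"
    "\<not> realised True (attach t1 s1)"
    using neg unfolding mergeable_def by blast
  obtain t2 s2 where 2: "realised False t2" "realised False s2" "tsize t2 + tsize s2 \<le> \<tau>"
    "\<not> realised False (attach t2 s2)"
    using neg unfolding mergeable_def by blast
  obtain t3 s3 where 3: "realised True t3" "realised False s3" "tsize t3 + tsize s3 \<le> \<tau>"
    "\<not> (realised True (attach t3 s3) \<and> realised False (attach s3 t3))"
  proof -
    consider "\<not> mergeable True False" | "\<not> mergeable False True" using neg by blast
    then show ?thesis
    proof cases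
      case 1
      then show ?thesis using that unfolding mergeable_def by blast
    next
      case 2
      then show ?thesis using that unfolding mergeable_def by (metis add.commute)
    qed
  qed
  \<comment> \<open>For \<open>p = q\<close> the merged tree is the first or the second
    counterexample. For \<open>p \<noteq> q\<close> both rootings of the third pair are produced,
    whichever tree starts at the source block.\<close>
  define ch where "ch p q = (if p then if q then s1 else t3 else if q then s3 else s2)" for p q
  define rt where "rt p q = (if q then if p then t1 else t3 else if p then s3 else t2)" for p q
  have "\<exists>p q. realised q (attach (rt p q) (ch p q)) \<and>
    (p \<noteq> q \<longrightarrow> realised p (attach (ch p q) (rt p q)))"
  proof (rule some_merge[OF assms])
    show "realised p (ch p q)" for p q using 1 2 3 by (cases p; cases q) (simp_all add: ch_def)
    show "realised q (rt p q)" for p q using 1 2 3 by (cases p; cases q) (simp_all add: rt_def)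
    show "tsize (ch p q) + tsize (rt p q) \<le> \<tau>" for p q
      using 1 2 3 by (cases p; cases q) (simp_all add: ch_def rt_def add.commute)
  qed
  then obtain p q where "realised q (attach (rt p q) (ch p q))"
    "p \<noteq> q \<longrightarrow> realised p (attach (ch p q) (rt p q))" by blast
  then show False using 1(4) 2(4) 3(4)
    by (cases p; cases q) (simp_all add: ch_def rt_def)
qed

text \<open>\<open>A\<close> is the set of sides that occur and \<open>c p\<close> is the side on
  which the children of a root on side \<open>p\<close> are realised. Taking \<open>c = id\<close>
  keeps one side throughout; \<open>c = Not\<close> alternates the sides from level to
  level.\<close>

lemma realised_dtree:
  assumes side: "\<And>p. p \<in> A \<Longrightarrow> c p \<in> A \<and> mergeable p (c p)"
    and \<delta>: "\<delta> \<ge> 2" "\<delta> ^ Suc \<eta> = \<tau>" and I: "I \<noteq> {}"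
  shows "k \<le> \<eta> \<Longrightarrow> p \<in> A \<Longrightarrow> realised p (dtree \<delta> k)"
proof (induction k arbitrary: p)
  case 0
  then show ?case using realised_leaf[OF I] by simp
next
  case (Suc k)
  let ?t = "dtree \<delta> k"
  have "Suc (\<delta> * tsize ?t) < \<delta> ^ Suc (Suc k)"
    using tsize_dtree[OF \<delta>(1), of "Suc k"] tsize_replicate[of \<delta> ?t] by simp
  also have "\<dots> \<le> \<tau>" unfolding \<delta>(2)[symmetric] using Suc.prems \<delta>(1) by (intro power_increasing) auto
  finally have size: "Suc (\<delta> * tsize ?t) \<le> \<tau>" by simp
  have child: "realised (c p) ?t" using side Suc by simp
  have "i \<le> \<delta> \<Longrightarrow> realised p (Node (replicate i ?t))" for i
  proof (induction i)
    case 0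
    then show ?case using realised_leaf[OF I] by simp
  next
    case (Suc i)
    have "Suc i * tsize ?t \<le> \<delta> * tsize ?t" using Suc.prems by (rule mult_right_mono) simp
    then have "tsize (Node (replicate i ?t)) + tsize ?t \<le> \<tau>"
      using size by (simp add: tsize_replicate del: tsize.simps)
    moreover have "realised (c p) ?t" using child .
    moreover have "realised p (Node (replicate i ?t))" using Suc by simp
    ultimately have "realised p (attach (Node (replicate i ?t)) ?t)"
      using side[OF \<open>p \<in> A\<close>] unfolding mergeable_def by blast
    then show ?case by (simp add: attach_def)
  qed
  then show ?case by simp
qed

lemma contains_dtree:
  assumes "\<delta> \<ge> 2" "\<delta> ^ Suc \<eta> = \<tau>" and I: "3 * \<tau> + 4 \<le> card I"
  shows "contains V E (T_verts \<delta> \<eta>) T_adj"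
proof -
  have ne: "I \<noteq> {}" using I by auto
  have "\<exists>p. realised p (dtree \<delta> \<eta>)"
  proof -
    consider "mergeable True True" | "mergeable False False" | "mergeable True False" "mergeable False True"
      using trichotomy[OF I] by blast
    then show ?thesis
    proof cases
      case 1
      then show ?thesis using realised_dtree[of "{True}" id \<delta> \<eta> \<eta> True] assms ne by auto
    next
      case 2
      then show ?thesis using realised_dtree[of "{False}" id \<delta> \<eta> \<eta> False] assms ne by auto
    next
      case 3
      then have "c \<in> UNIV \<and> mergeable p (\<not> p)" for p c by (cases p) auto
      then show ?thesis using realised_dtree[of UNIV Not \<delta> \<eta> \<eta> True] assms ne by auto
    qed
  qed
  then obtain p where p: "realised p (dtree \<delta> \<eta>)" by blast
  have "tsize (dtree \<delta> \<eta>) \<le> card I" using tsize_dtree[OF assms(1), of \<eta>] assms(2) I by linarith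
  then obtain S where S: "S \<subseteq> I" "card S = tsize (dtree \<delta> \<eta>)"
    using obtain_subset_with_card_n by metis
  have "\<kappa> * w \<le> w" using kappa_w by (simp add: order_trans)
  then have "\<forall>i\<in>S. B i \<subseteq> B i \<and> \<kappa> * w \<le> card (B i)" using S(1) block_card by auto
  then obtain x where x: "\<And>i. i \<in> S \<Longrightarrow> x i \<in> B i"
    and emb: "emb (\<lambda>i j. E (x i) (x j)) (dtree \<delta> \<eta>) (ext p S) S"
    using p S unfolding realised_def by metis
  have inj: "inj_on x S"
    using x block_disj S(1) by (intro inj_onI) (metis disjoint_iff subset_iff)
  have xV: "x i \<in> V" if "i \<in> S" for i using x[OF that] block_sub S(1) that by blast
  have "\<exists>f. inj_on f (words (dtree \<delta> \<eta>)) \<and> f ` words (dtree \<delta> \<eta>) = S \<and> f [] = ext p S \<and>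
    (\<forall>a\<in>words (dtree \<delta> \<eta>). \<forall>b\<in>words (dtree \<delta> \<eta>). T_adj a b \<longleftrightarrow> E (x (f a)) (x (f b)))"
    by (rule emb_words[OF emb]) (use xV E_sym E_irrefl in blast)+
  then obtain f where f: "inj_on f (T_verts \<delta> \<eta>)" "f ` T_verts \<delta> \<eta> = S"
    "\<forall>a\<in>T_verts \<delta> \<eta>. \<forall>b\<in>T_verts \<delta> \<eta>. T_adj a b \<longleftrightarrow> E (x (f a)) (x (f b))"
    unfolding words_dtree by blast
  show ?thesis
    unfolding contains_def
  proof (intro exI[of _ "x \<circ> f"] conjI)
    show "inj_on (x \<circ> f) (T_verts \<delta> \<eta>)" using f(1,2) inj by (simp add: comp_inj_on)
    show "(x \<circ> f) ` T_verts \<delta> \<eta> \<subseteq> V" using f(2) xV by (auto simp: image_comp[symmetric])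
  qed (use f(3) in simp)
qed

end

section \<open>From the hypotheses of the theorem to the abstract setting\<close>

theorem theorem3p1:
  fixes \<delta> \<eta> :: nat and lam \<epsilon> :: real
    and V :: "'a set" and E :: "'a \<Rightarrow> 'a \<Rightarrow> bool"
    and I :: "int set" and B :: "int \<Rightarrow> 'a set"
  assumes "\<delta> \<ge> 2"
    and "0 < lam" and "lam \<le> 1 / (2 ^ (9 * \<delta>) * real \<delta> ^ (1 + \<eta>))"
    and "\<epsilon> > 0"
    and "graph V E"
    and "coherent \<epsilon> V E"
    and "blockade V I B"
    and "equicardinal I B"
    and "real (blen I) \<ge> 6 * real \<delta> ^ (\<eta> + 2)"
    and "real (bwidth I B) \<ge> 2 ^ (9 * \<delta>) * \<epsilon> * real (card V)"
    and "concave E lam I B"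
    and "support_uniform E (\<delta> ^ (1 + \<eta>)) I B"
    and "support_invariant E (1 / 2 ^ (9 * \<delta>)) (\<delta> ^ (1 + \<eta>)) I B"
  shows "contains V E (T_verts \<delta> \<eta>) T_adj"
proof -
  define \<kappa> :: real where "\<kappa> = 1 / 2 ^ (9 * \<delta>)"
  define \<tau> where "\<tau> = \<delta> ^ (1 + \<eta>)"
  define w where "w = bwidth I B"
  have \<tau>1: "\<tau> \<ge> 1" using assms(1) by (simp add: \<tau>_def)
  have "real (6 * \<delta> * \<tau>) \<le> real (card I)"
    using assms(9) by (simp add: blen_def \<tau>_def power_add power2_eq_square)
  \<comment> \<open>The length is at least 12\<tau>, which exceeds the 3\<tau> + 4 blocks used by
    the trichotomy.\<close>
  then have "6 * \<delta> * \<tau> \<le> card I" by (simp only: of_nat_le_iff)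
  moreover have "12 * \<tau> \<le> 6 * \<delta> * \<tau>" using assms(1) by simp
  ultimately have cI: "3 * \<tau> + 4 \<le> card I" using \<tau>1 by linarith
  then have ne: "I \<noteq> {}" by auto
  have finI: "finite I" using assms(7) by (simp add: blockade_def)
  have card_B: "card (B i) = w" if "i \<in> I" for i
  proof -
    have "(\<lambda>i. card (B i)) ` I = {card (B i)}"
      using assms(8) that unfolding equicardinal_def by blast
    then show ?thesis by (simp add: w_def bwidth_def)
  qed
  have kw: "\<epsilon> * card V \<le> \<kappa> * w"
    using assms(10) by (simp add: \<kappa>_def w_def field_simps)
  have finV: "finite V" using assms(5) by (simp add: graph_def)
  interpret uniform_blockade V E I B w \<tau> \<kappa> lam
  proof
    show "0 < w"
    proof -
      obtain i where i: "i \<in> I" using ne by blast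
      then have "B i \<noteq> {}" "finite (B i)"
        using assms(7) finV finite_subset unfolding blockade_def by blast+
      then show ?thesis using card_B[OF i] by (metis card_gt_0_iff)
    qed
    show "real (card {u \<in> V. E v u}) < \<kappa> * w" if "v \<in> V" for v
    proof -
      have "real (card {u \<in> V. E v u}) < \<epsilon> * card V"
        using assms(6) that unfolding coherent_def degree_def by blast
      then show ?thesis using kw by linarith
    qed
    show "\<exists>u\<in>P. \<exists>v\<in>Q. E u v"
      if "P \<subseteq> V" "Q \<subseteq> V" "P \<inter> Q = {}" "\<kappa> * w \<le> card P" "\<kappa> * w \<le> card Q" for P Q
    proof -
      have "\<epsilon> * card V \<le> card P" "\<epsilon> * card V \<le> card Q" using kw that by linarith+
      then show ?thesis using assms(6) that(1-3) unfolding coherent_def by blast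
    qed
    show "\<kappa> \<le> 1 / 1000"
    proof -
      have "(2::real) ^ 18 \<le> 2 ^ (9 * \<delta>)" using assms(1) by (intro power_increasing) auto
      then have "(1000::real) \<le> 2 ^ (9 * \<delta>)" by simp
      then show ?thesis by (simp add: \<kappa>_def field_simps)
    qed
    show "lam * \<tau> \<le> \<kappa>"
    proof -
      have "lam * \<tau> \<le> 1 / (2 ^ (9 * \<delta>) * real \<delta> ^ (1 + \<eta>)) * \<tau>"
        using assms(3) by (rule mult_right_mono) simp
      also have "\<dots> = \<kappa>" using assms(1) by (simp add: \<kappa>_def \<tau>_def)
      finally show ?thesis .
    qed
    show "B i \<subseteq> V" if "i \<in> I" for i using assms(7) that by (simp add: blockade_def)
    show "B i \<inter> B j = {}" if "i \<in> I" "j \<in> I" "i \<noteq> j" for i j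
      using assms(7) that by (simp add: blockade_def)
    show "bwidth I B = w" by (simp add: w_def)
    show "0 < \<kappa>" by (simp add: \<kappa>_def)
    show "support_uniform E \<tau> I B" using assms(12) by (simp add: \<tau>_def)
    show "support_invariant E \<kappa> \<tau> I B" using assms(13) by (simp add: \<tau>_def \<kappa>_def)
  qed (fact assms finI card_B \<tau>1)+
  show ?thesis by (rule contains_dtree[OF assms(1) _ cI]) (simp add: \<tau>_def)
qed

end
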